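(* Let $k$ be an algebraically closed field and $q$ a prime number different from the characteristic of $k$. Let $f$ and $g$ be nonzero irreducible elements of $k[x][[y]]$, the ring of power series in $y$ with coefficients that are polynomials in $x$. Suppose the curve defined by $f=0$ is nonsingular. If $f$ is a $q$th power modulo $g$, then $g$ is a $q$th power modulo $f$.
   Context: For $a,b\in k[x][[y]]$, "$a$ is a $q$th power modulo $b$" means there is $h\in k[x][[y]]$ with $a-h^q\in b\,k[x][[y]]$. The curve defined by $f=0$ is $\operatorname{Spec}\bigl(k[x][[y]]/(f)\bigr)$; nonsingular means that this scheme is regular. *)

theory Defs
  imports
    "HOL-Computational_Algebra.Computational_Algebra"
    "HOL-Library.Extended_Nat"
    "HOL-Algebra.Algebraic_Closure_Type"
begin

section \<open>Localization of a commutative ring\<close>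

text \<open>
  Fractions \<open>a/s\<close> are pairs \<open>(a, s)\<close> with \<open>s\<close> in the multiplicative set \<open>S\<close>. The extra factor \<open>u\<close>
  is needed because \<open>S\<close> may contain zero divisors.
\<close>

definition frac_rel :: "('a, 'm) ring_scheme \<Rightarrow> 'a set \<Rightarrow> (('a \<times> 'a) \<times> ('a \<times> 'a)) set" where
  "frac_rel R S =
     {((a, s), (b, t)) | a s b t. a \<in> carrier R \<and> s \<in> S \<and> b \<in> carrier R \<and> t \<in> S \<and>
        (\<exists>u\<in>S. u \<otimes>\<^bsub>R\<^esub> (t \<otimes>\<^bsub>R\<^esub> a) = u \<otimes>\<^bsub>R\<^esub> (s \<otimes>\<^bsub>R\<^esub> b))}"

definition mk_frac :: "('a, 'm) ring_scheme \<Rightarrow> 'a set \<Rightarrow> 'a \<Rightarrow> 'a \<Rightarrow> ('a \<times> 'a) set" where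
  "mk_frac R S a s = frac_rel R S `` {(a, s)}"

definition localization :: "('a, 'm) ring_scheme \<Rightarrow> 'a set \<Rightarrow> ('a \<times> 'a) set ring" where
  "localization R S =
     \<lparr>carrier = (carrier R \<times> S) // frac_rel R S,
      monoid.mult = (\<lambda>C D. \<Union>(a, s)\<in>C. \<Union>(b, t)\<in>D.
               mk_frac R S (a \<otimes>\<^bsub>R\<^esub> b) (s \<otimes>\<^bsub>R\<^esub> t)),
      one = mk_frac R S \<one>\<^bsub>R\<^esub> \<one>\<^bsub>R\<^esub>,
      ring.zero = mk_frac R S \<zero>\<^bsub>R\<^esub> \<one>\<^bsub>R\<^esub>,
      add = (\<lambda>C D. \<Union>(a, s)\<in>C. \<Union>(b, t)\<in>D.
               mk_frac R S ((t \<otimes>\<^bsub>R\<^esub> a) \<oplus>\<^bsub>R\<^esub> (s \<otimes>\<^bsub>R\<^esub> b)) (s \<otimes>\<^bsub>R\<^esub> t))\<rparr>"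

text \<open>The stalk of the structure sheaf of \<open>Spec R\<close> at the prime \<open>P\<close>.\<close>

definition local_ring_at :: "('a, 'm) ring_scheme \<Rightarrow> 'a set \<Rightarrow> ('a \<times> 'a) set ring" where
  "local_ring_at R P = localization R (carrier R - P)"

locale mult_subset = cring R for R (structure) +
  fixes S
  assumes S_sub: "S \<subseteq> carrier R"
    and S_one: "\<one> \<in> S"
    and S_mult: "\<lbrakk>s \<in> S; t \<in> S\<rbrakk> \<Longrightarrow> s \<otimes> t \<in> S"
begin

lemma S_carr [simp, intro]: "s \<in> S \<Longrightarrow> s \<in> carrier R"
  using S_sub by blast

lemma frac_relI:
  assumes "a \<in> carrier R" "s \<in> S" "b \<in> carrier R" "t \<in> S" "u \<in> S"
    "u \<otimes> (t \<otimes> a) = u \<otimes> (s \<otimes> b)"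
  shows "((a, s), (b, t)) \<in> frac_rel R S"
  using assms by (auto simp: frac_rel_def)

lemma frac_relE:
  assumes "((a, s), (b, t)) \<in> frac_rel R S"
  obtains u where "a \<in> carrier R" "s \<in> S" "b \<in> carrier R" "t \<in> S" "u \<in> S"
    "u \<otimes> (t \<otimes> a) = u \<otimes> (s \<otimes> b)"
  using assms by (auto simp: frac_rel_def)

lemma equiv_frac_rel: "equiv (carrier R \<times> S) (frac_rel R S)"
proof (rule equivI)
  show "frac_rel R S \<subseteq> (carrier R \<times> S) \<times> carrier R \<times> S"
    by (auto simp: frac_rel_def)
  show "refl_on (carrier R \<times> S) (frac_rel R S)"
    by (auto simp: refl_on_def intro: frac_relI[OF _ _ _ _ S_one])
  show "sym (frac_rel R S)"
  proof (rule symI, clarify)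
    fix a s b t assume "((a, s), (b, t)) \<in> frac_rel R S"
    thus "((b, t), (a, s)) \<in> frac_rel R S"
      by (auto simp: frac_rel_def intro: sym)
  qed
  show "trans (frac_rel R S)"
  proof (rule transI, clarify)
    fix a s b t c r
    assume "((a, s), (b, t)) \<in> frac_rel R S" "((b, t), (c, r)) \<in> frac_rel R S"
    then obtain u v where
      c: "a \<in> carrier R" "s \<in> S" "b \<in> carrier R" "t \<in> S" "u \<in> S" "c \<in> carrier R" "r \<in> S" "v \<in> S"
      and e: "u \<otimes> (t \<otimes> a) = u \<otimes> (s \<otimes> b)" "v \<otimes> (r \<otimes> b) = v \<otimes> (t \<otimes> c)"
      by (elim frac_relE) blast
    have "(u \<otimes> v \<otimes> t) \<otimes> (r \<otimes> a) = v \<otimes> r \<otimes> (u \<otimes> (t \<otimes> a))"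
      using c by (simp add: m_ac)
    also have "\<dots> = u \<otimes> s \<otimes> (v \<otimes> (r \<otimes> b))"
      unfolding e(1) using c by (simp add: m_ac)
    also have "\<dots> = (u \<otimes> v \<otimes> t) \<otimes> (s \<otimes> c)"
      unfolding e(2) using c by (simp add: m_ac)
    finally show "((a, s), (c, r)) \<in> frac_rel R S"
      using c by (intro frac_relI[where u = "u \<otimes> v \<otimes> t"]) (auto intro: S_mult)
  qed
qed

lemma frac_eq_iff:
  assumes "a \<in> carrier R" "s \<in> S" "b \<in> carrier R" "t \<in> S"
  shows "mk_frac R S a s = mk_frac R S b t \<longleftrightarrow> (\<exists>u\<in>S. u \<otimes> (t \<otimes> a) = u \<otimes> (s \<otimes> b))"
proof -
  have "mk_frac R S a s = mk_frac R S b t \<longleftrightarrow> ((a, s), (b, t)) \<in> frac_rel R S"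
    unfolding mk_frac_def using assms by (intro eq_equiv_class_iff[OF equiv_frac_rel]) auto
  thus ?thesis using assms by (auto simp: frac_rel_def)
qed

lemma frac_eqI:
  assumes "a \<in> carrier R" "s \<in> S" "b \<in> carrier R" "t \<in> S" "t \<otimes> a = s \<otimes> b"
  shows "mk_frac R S a s = mk_frac R S b t"
  using assms by (subst frac_eq_iff) (auto intro!: bexI[OF _ S_one])

lemma carrier_localization:
  "carrier (localization R S) = {mk_frac R S a s | a s. a \<in> carrier R \<and> s \<in> S}"
  by (auto simp: localization_def quotient_def mk_frac_def)

lemma frac_closed [intro]:
  "\<lbrakk>a \<in> carrier R; s \<in> S\<rbrakk> \<Longrightarrow> mk_frac R S a s \<in> carrier (localization R S)"
  by (auto simp: carrier_localization)

lemma frac_cases: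
  assumes "x \<in> carrier (localization R S)"
  obtains a s where "a \<in> carrier R" "s \<in> S" "x = mk_frac R S a s"
  using assms by (auto simp: carrier_localization)

lemma localization_mult:
  assumes "a \<in> carrier R" "s \<in> S" "b \<in> carrier R" "t \<in> S"
  shows "mk_frac R S a s \<otimes>\<^bsub>localization R S\<^esub> mk_frac R S b t = mk_frac R S (a \<otimes> b) (s \<otimes> t)"
proof -
  let ?f = "\<lambda>(a, s) (b, t). mk_frac R S (a \<otimes> b) (s \<otimes> t)"
  have "congruent2 (frac_rel R S) (frac_rel R S) ?f"
  proof (rule congruent2I', clarify)
    fix a s a' s' b t b' t'
    assume "((a, s), (a', s')) \<in> frac_rel R S" "((b, t), (b', t')) \<in> frac_rel R S"
    then obtain u v where
      c: "a \<in> carrier R" "s \<in> S" "a' \<in> carrier R" "s' \<in> S" "u \<in> S"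
         "b \<in> carrier R" "t \<in> S" "b' \<in> carrier R" "t' \<in> S" "v \<in> S"
      and e: "u \<otimes> (s' \<otimes> a) = u \<otimes> (s \<otimes> a')" "v \<otimes> (t' \<otimes> b) = v \<otimes> (t \<otimes> b')"
      by (elim frac_relE) blast
    have "(u \<otimes> v) \<otimes> ((s' \<otimes> t') \<otimes> (a \<otimes> b)) = (u \<otimes> (s' \<otimes> a)) \<otimes> (v \<otimes> (t' \<otimes> b))"
      using c by (simp add: m_ac)
    also have "\<dots> = (u \<otimes> v) \<otimes> ((s \<otimes> t) \<otimes> (a' \<otimes> b'))"
      unfolding e using c by (simp add: m_ac)
    finally show "mk_frac R S (a \<otimes> b) (s \<otimes> t) = mk_frac R S (a' \<otimes> b') (s' \<otimes> t')"
      using c by (subst frac_eq_iff) (auto intro: S_mult bexI[of _ "u \<otimes> v"])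
  qed
  from UN_equiv_class2[OF equiv_frac_rel equiv_frac_rel this, of "(a, s)" "(b, t)"]
  show ?thesis using assms
    by (simp add: localization_def mk_frac_def case_prod_unfold)
qed

lemma localization_add:
  assumes "a \<in> carrier R" "s \<in> S" "b \<in> carrier R" "t \<in> S"
  shows "mk_frac R S a s \<oplus>\<^bsub>localization R S\<^esub> mk_frac R S b t
           = mk_frac R S ((t \<otimes> a) \<oplus> (s \<otimes> b)) (s \<otimes> t)"
proof -
  let ?f = "\<lambda>(a, s) (b, t). mk_frac R S ((t \<otimes> a) \<oplus> (s \<otimes> b)) (s \<otimes> t)"
  have "congruent2 (frac_rel R S) (frac_rel R S) ?f"
  proof (rule congruent2I', clarify)
    fix a s a' s' b t b' t'
    assume "((a, s), (a', s')) \<in> frac_rel R S" "((b, t), (b', t')) \<in> frac_rel R S"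
    then obtain u v where
      c: "a \<in> carrier R" "s \<in> S" "a' \<in> carrier R" "s' \<in> S" "u \<in> S"
         "b \<in> carrier R" "t \<in> S" "b' \<in> carrier R" "t' \<in> S" "v \<in> S"
      and e: "u \<otimes> (s' \<otimes> a) = u \<otimes> (s \<otimes> a')" "v \<otimes> (t' \<otimes> b) = v \<otimes> (t \<otimes> b')"
      by (elim frac_relE) blast
    have "(u \<otimes> v) \<otimes> ((s' \<otimes> t') \<otimes> ((t \<otimes> a) \<oplus> (s \<otimes> b)))
        = v \<otimes> t \<otimes> t' \<otimes> (u \<otimes> (s' \<otimes> a)) \<oplus> u \<otimes> s \<otimes> s' \<otimes> (v \<otimes> (t' \<otimes> b))"
      using c by (simp add: m_ac r_distr)
    also have "\<dots> = (u \<otimes> v) \<otimes> ((s \<otimes> t) \<otimes> ((t' \<otimes> a') \<oplus> (s' \<otimes> b')))"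
      unfolding e using c by (simp add: m_ac r_distr)
    finally show "mk_frac R S ((t \<otimes> a) \<oplus> (s \<otimes> b)) (s \<otimes> t)
        = mk_frac R S ((t' \<otimes> a') \<oplus> (s' \<otimes> b')) (s' \<otimes> t')"
      using c by (subst frac_eq_iff) (auto intro: S_mult bexI[of _ "u \<otimes> v"])
  qed
  from UN_equiv_class2[OF equiv_frac_rel equiv_frac_rel this, of "(a, s)" "(b, t)"]
  show ?thesis using assms
    by (simp add: localization_def mk_frac_def case_prod_unfold)
qed

lemma localization_one: "\<one>\<^bsub>localization R S\<^esub> = mk_frac R S \<one> \<one>"
  and localization_zero: "\<zero>\<^bsub>localization R S\<^esub> = mk_frac R S \<zero> \<one>"
  by (simp_all add: localization_def)

lemma cring_localization: "cring (localization R S)"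
proof (rule cringI)
  note [simp] = localization_mult localization_add localization_one localization_zero S_mult S_one
  note ac = m_ac a_ac r_distr l_distr
  show "abelian_group (localization R S)"
  proof (rule abelian_groupI)
    fix x assume "x \<in> carrier (localization R S)"
    then obtain a s where x: "a \<in> carrier R" "s \<in> S" "x = mk_frac R S a s" by (rule frac_cases)
    have "mk_frac R S (\<ominus> a) s \<oplus>\<^bsub>localization R S\<^esub> x = \<zero>\<^bsub>localization R S\<^esub>"
      using x by (simp add: r_minus l_neg) (rule frac_eqI, auto)
    thus "\<exists>y\<in>carrier (localization R S). y \<oplus>\<^bsub>localization R S\<^esub> x = \<zero>\<^bsub>localization R S\<^esub>"
      using x by blast
  qed (auto elim!: frac_cases intro!: frac_eqI frac_closed simp: ac)
  show "Group.comm_monoid (localization R S)"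
    by (rule comm_monoidI) (auto elim!: frac_cases intro!: frac_eqI frac_closed simp: ac)
  let ?L = "localization R S"
  fix x y z assume "x \<in> carrier ?L" "y \<in> carrier ?L" "z \<in> carrier ?L"
  then obtain a s b t c r where c: "a \<in> carrier R" "s \<in> S" "b \<in> carrier R" "t \<in> S"
    "c \<in> carrier R" "r \<in> S" and e: "x = mk_frac R S a s" "y = mk_frac R S b t" "z = mk_frac R S c r"
    by (elim frac_cases) blast
  have "mk_frac R S ((t \<otimes> a \<oplus> s \<otimes> b) \<otimes> c) (s \<otimes> t \<otimes> r)
      = mk_frac R S (t \<otimes> r \<otimes> (a \<otimes> c) \<oplus> s \<otimes> r \<otimes> (b \<otimes> c)) (s \<otimes> r \<otimes> (t \<otimes> r))"
    by (rule frac_eqI) (use c in \<open>auto simp: ac\<close>)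
  thus "(x \<oplus>\<^bsub>?L\<^esub> y) \<otimes>\<^bsub>?L\<^esub> z = x \<otimes>\<^bsub>?L\<^esub> z \<oplus>\<^bsub>?L\<^esub> y \<otimes>\<^bsub>?L\<^esub> z"
    using c by (simp add: e)
qed

end

lemma mult_subset_prime_compl:
  assumes "primeideal P R"
  shows "mult_subset R (carrier R - P)"
proof -
  interpret primeideal P R by fact
  show ?thesis
    by unfold_locales (use I_notcarr one_imp_carrier I_prime in auto)
qed

lemma cring_local_ring_at: "primeideal P R \<Longrightarrow> cring (local_ring_at R P)"
  unfolding local_ring_at_def by (intro mult_subset.cring_localization mult_subset_prime_compl)


section \<open>Regularity\<close>

definition krull_dim :: "('a, 'm) ring_scheme \<Rightarrow> enat" where
  "krull_dim R =
     Sup {enat n | n. \<exists>P :: nat \<Rightarrow> 'a set.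
            (\<forall>i\<le>n. primeideal (P i) R) \<and> (\<forall>i<n. P i \<subset> P (Suc i))}"

definition regular_local_ring :: "('a, 'm) ring_scheme \<Rightarrow> bool" where
  "regular_local_ring R \<longleftrightarrow>
     cring R \<and> noetherian_ring R \<and>
     (\<exists>M. {J. maximalideal J R} = {M} \<and>
        (\<exists>A \<subseteq> carrier R. finite A \<and> Idl\<^bsub>R\<^esub> A = M \<and> enat (card A) = krull_dim R))"

text \<open>A scheme is regular if all its local rings are regular local rings.\<close>

definition regular_Spec :: "('a, 'm) ring_scheme \<Rightarrow> bool" where
  "regular_Spec R \<longleftrightarrow> (\<forall>P. primeideal P R \<longrightarrow> regular_local_ring (local_ring_at R P))"


section \<open>Curves defined by elements of \<open>k[x][[y]]\<close>\<close>

text \<open>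
  \<open>k[x][[y]]\<close> is the type \<open>'k poly fps\<close>; \<^const>\<open>ring_of_type_algebra\<close> turns it into a record so that
  quotients and localizations can be formed.
\<close>

definition coordinate_ring :: "'k :: field poly fps \<Rightarrow> 'k poly fps set ring" where
  "coordinate_ring f =
     (ring_of_type_algebra :: 'k poly fps ring) Quot (PIdl\<^bsub>ring_of_type_algebra\<^esub> f)"

definition nonsingular_curve :: "'k :: field poly fps \<Rightarrow> bool" where
  "nonsingular_curve f \<longleftrightarrow> regular_Spec (coordinate_ring f)"

definition power_modulo :: "nat \<Rightarrow> 'k :: field poly fps \<Rightarrow> 'k poly fps \<Rightarrow> bool" where
  "power_modulo q a b \<longleftrightarrow> (\<exists>h. b dvd a - h ^ q)"

end

theory Submission
  imports Defs
begin

text \<open>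
  Write \<open>A = k[x][[y]]\<close>. The theorem comes from the symmetry of the intersection number
  \<open>dim\<^sub>k A/(f,g)\<close>: if \<open>f \<equiv> h\<^sup>q\<close> modulo \<open>g\<close>, this number equals \<open>dim\<^sub>k A/(g,h\<^sup>q) = q dim\<^sub>k A/(g,h)\<close>
  and so is divisible by \<open>q\<close>; on the nonsingular curve \<open>f = 0\<close> it is the order of vanishing of \<open>g\<close>,
  which decides whether \<open>g\<close> is a \<open>q\<close>th power.
  
  By Hensel's lemma an irreducible \<open>f\<close> that is not an associate of \<open>y\<close> meets the line \<open>y = 0\<close> in a single
  point: \<open>f(x,0) = c(x - a)\<^sup>n\<close> (\<open>irreducible_constant_coefficient\<close>). Hence \<open>A/(f)\<close> is local and complete.
  If the curve is nonsingular, one element \<open>t\<close> generates its maximal ideal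
  (\<open>nonsingular_local_parameter\<close>), and \<open>g \<equiv> t\<^sup>m w\<close> modulo \<open>f\<close> with \<open>w(a,0) \<noteq> 0\<close> (\<open>order_obtain\<close>). By
  Newton iteration \<open>w\<close> is a \<open>q\<close>th power modulo \<open>f\<close> (\<open>root_mod_if_nonzero_at_point\<close>), so it is
  enough that \<open>q\<close> divides \<open>m\<close>. When \<open>f\<close> is an associate of \<open>y\<close>, the ring \<open>A/(f)\<close> is \<open>k[x]\<close>; then
  \<open>t = x - a\<close> and a constant \<open>w\<close> do the same job, because \<open>g(x,0) = c(x - a)\<^sup>m\<close>.
  
  The divisibility (\<open>exponent_dvd_order\<close>) is proved with colon ideals in place of dimensions. Put
  \<open>J = (f,g) = (f,t\<^sup>m) = (g,h\<^sup>q)\<close>. Since \<open>h\<close> is not a zero divisor modulo \<open>g\<close>, the second description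
  gives \<open>(J : h) = (g,h\<^sup>q\<^sup>-\<^sup>1)\<close>. Since the ideals that contain \<open>J\<close> are the \<open>(f,t\<^sup>i)\<close>, the first
  one gives \<open>(J : h) = (f,t\<^sup>m\<^sup>-\<^sup>l)\<close>, where \<open>l\<close> is the order of \<open>h\<close>. Comparing exponents yields
  \<open>m - l = (q - 1) l\<close>.
\<close>

text \<open>
  Evaluation at the point \<open>(a,0)\<close>; its kernel is the maximal ideal \<open>(x - a, y)\<close>. Over an
  algebraically closed field these points are all the closed points of \<open>Spec k[x][[y]]\<close>.
\<close>

definition at_point :: "'k::comm_ring_1 \<Rightarrow> 'k poly fps \<Rightarrow> 'k" where
  "at_point a p = poly (fps_nth p 0) a"

lemma at_point_simps [simp]:
  "at_point a 0 = 0" "at_point a 1 = 1" "at_point a fps_X = 0"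
  "at_point a (p + r) = at_point a p + at_point a r"
  "at_point a (p - r) = at_point a p - at_point a r"
  "at_point a (- p) = - at_point a p"
  "at_point a (p * r) = at_point a p * at_point a r"
  "at_point a (p ^ n) = at_point a p ^ n"
  "at_point a (fps_const s) = poly s a"
  by (simp_all add: at_point_def fps_power_zeroth)

lemma at_point_of_nat [simp]: "at_point a (of_nat n) = of_nat n"
  by (induction n) simp_all

lemma at_point_dvd: "f dvd p \<Longrightarrow> at_point a f = 0 \<Longrightarrow> at_point a p = 0"
  by (auto elim!: dvdE)

section \<open>The \<open>y\<close>-adic topology\<close>

lemma fps_X_power_dvd_iff:
  "fps_X ^ n dvd (p :: 'a::comm_ring_1 fps) \<longleftrightarrow> (\<forall>i<n. fps_nth p i = 0)"
proof
  assume "\<forall>i<n. fps_nth p i = 0"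
  then have "p = fps_X ^ n * fps_shift n p"
    by (auto simp: fps_eq_iff fps_X_power_mult_nth)
  then show "fps_X ^ n dvd p" by (rule dvdI)
qed (auto elim!: dvdE simp: fps_X_power_mult_nth)

lemma fps_X_dvd_iff: "fps_X dvd (p :: 'a::comm_ring_1 fps) \<longleftrightarrow> fps_nth p 0 = 0"
  using fps_X_power_dvd_iff[of 1 p] by simp

lemma dvd_fps_X_mod_obtain:
  fixes b c :: "'a::comm_ring_1 fps"
  assumes "fps_nth b 0 dvd fps_nth c 0"
  obtains u c' where "c = b * u + fps_X * c'"
proof -
  from assms obtain s where "fps_nth c 0 = fps_nth b 0 * s" ..
  then have "fps_X dvd c - b * fps_const s" by (simp add: fps_X_dvd_iff)
  then obtain c' where "c - b * fps_const s = fps_X * c'" ..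
  then have "c = b * fps_const s + fps_X * c'" by (simp add: algebra_simps)
  then show thesis by (rule that)
qed

lemma fps_X_power_dvd_cancel:
  fixes b z :: "'a::idom fps"
  assumes "\<not> fps_X dvd b" "fps_X ^ n dvd b * z"
  shows "fps_X ^ n dvd z"
  using assms(2)
proof (induction n arbitrary: z)
  case (Suc n)
  then have "fps_X dvd b * z" by (auto elim: dvd_trans[rotated])
  then have "fps_X dvd z" using assms(1) by (auto simp: fps_X_dvd_iff)
  then obtain z' where z: "z = fps_X * z'" ..
  from Suc.prems have "fps_X * fps_X ^ n dvd fps_X * (b * z')" by (simp add: z mult_ac)
  then have "fps_X ^ n dvd b * z'" by (subst (asm) dvd_mult_cancel_left) simp
  then show ?case using Suc.IH[of z'] by (simp add: z)
qed simp

lemma dvd_fps_X_power_mult_cancel: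
  fixes b z :: "'a::idom fps"
  assumes "\<not> fps_X dvd b" "b dvd fps_X ^ n * z"
  shows "b dvd z"
proof -
  from assms(2) obtain v where v: "fps_X ^ n * z = b * v" ..
  then have "fps_X ^ n dvd b * v" by (metis dvd_triv_left)
  with assms(1) have "fps_X ^ n dvd v" by (rule fps_X_power_dvd_cancel)
  then obtain v' where "v = fps_X ^ n * v'" ..
  with v have "fps_X ^ n * z = fps_X ^ n * (b * v')" by (simp add: mult_ac)
  then have "z = b * v'" by simp
  then show ?thesis by simp
qed

lemma fps_X_adic_limit:
  fixes s :: "nat \<Rightarrow> 'a::comm_ring_1 fps"
  assumes "\<And>i. fps_X ^ i dvd s (Suc i) - s i"
  obtains l where "\<And>i. fps_X ^ i dvd l - s i"
proof -
  have step: "fps_nth (s (Suc i)) j = fps_nth (s i) j" if "j < i" for j i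
    using assms[of i] that by (auto simp: fps_X_power_dvd_iff)
  have stable: "fps_nth (s i) j = fps_nth (s (Suc j)) j" if "j < i" for i j
    using that
  proof (induction i)
    case (Suc i)
    show ?case
    proof (cases "j = i")
      case False
      then have "j < i" using Suc.prems by simp
      then show ?thesis using Suc.IH step[of j i] by metis
    qed simp
  qed simp
  have "fps_X ^ i dvd Abs_fps (\<lambda>j. fps_nth (s (Suc j)) j) - s i" for i
    unfolding fps_X_power_dvd_iff
  proof (intro allI impI)
    fix j assume "j < i"
    have "fps_nth (Abs_fps (\<lambda>j. fps_nth (s (Suc j)) j) - s i) j = fps_nth (s (Suc j)) j - fps_nth (s i) j"
      by (simp only: fps_sub_nth fps_nth_Abs_fps)
    also have "\<dots> = 0" unfolding stable[OF \<open>j < i\<close>] by (rule diff_self)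
    finally show "fps_nth (Abs_fps (\<lambda>j. fps_nth (s (Suc j)) j) - s i) j = 0" .
  qed
  then show thesis by (rule that)
qed

lemma fps_X_adic_separated:
  fixes p :: "'a::comm_ring_1 fps"
  assumes "\<And>i. fps_X ^ i dvd p"
  shows "p = 0"
proof (rule fps_ext)
  fix i
  show "fps_nth p i = fps_nth 0 i"
    using assms[of "Suc i"] unfolding fps_X_power_dvd_iff by simp
qed

text \<open>
  Principal ideals are closed in the \<open>y\<close>-adic topology. If \<open>y\<close> does not divide \<open>b\<close>, approximate
  quotients of \<open>c\<close> by \<open>b\<close> are unique modulo powers of \<open>y\<close>, so they converge to a quotient. Exact
  divisibility can thus be checked modulo every power of \<open>y\<close>.
\<close>

lemma principal_ideal_closed:
  fixes b c :: "'a::idom fps"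
  assumes b: "\<not> fps_X dvd b" and "\<And>i. \<exists>u. fps_X ^ i dvd c - b * u"
  shows "b dvd c"
proof -
  from assms(2) obtain u where u: "\<And>i. fps_X ^ i dvd c - b * u i" by metis
  have "fps_X ^ i dvd u (Suc i) - u i" for i
  proof (rule fps_X_power_dvd_cancel[OF b])
    have "fps_X ^ i dvd c - b * u (Suc i)"
      using u[of "Suc i"] by (rule dvd_trans[rotated]) simp
    from dvd_diff[OF u this] show "fps_X ^ i dvd b * (u (Suc i) - u i)"
      by (simp add: algebra_simps)
  qed
  then obtain l where l: "\<And>i. fps_X ^ i dvd l - u i" by (rule fps_X_adic_limit) blast
  have "fps_X ^ i dvd c - b * l" for i
    using dvd_diff[OF u[of i] dvd_mult[OF l[of i], of b]] by (simp add: algebra_simps)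
  then have "c - b * l = 0" by (rule fps_X_adic_separated)
  then show ?thesis by (simp add: dvd_def exI[of _ l])
qed

section \<open>Irreducible series\<close>

lemma fps_dvd_one_iff:
  "(p :: 'a::comm_ring_1 fps) dvd 1 \<longleftrightarrow> fps_nth p 0 dvd 1"
proof
  assume "fps_nth p 0 dvd 1"
  then obtain c where "1 = fps_nth p 0 * c" ..
  then have "p * fps_right_inverse p c = 1" by (intro fps_right_inverse) simp
  then show "p dvd 1" by (metis dvdI)
next
  assume "p dvd 1"
  then obtain r where "1 = p * r" ..
  then have "1 = fps_nth p 0 * fps_nth r 0" by (metis fps_mult_nth_0 fps_one_nth)
  then show "fps_nth p 0 dvd 1" ..
qed

text \<open>
  Hensel's lemma without degree bounds. The correction at each stage only has to solve
  \<open>\<delta>F r + p \<delta>G = e\<close>, where \<open>e\<close> is the leading coefficient of the current error, and any Bezout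
  relation does this: every sequence of coefficients is a power series, so degrees in \<open>x\<close> may grow.
\<close>

lemma hensel_factorization:
  fixes f :: "'a::comm_ring_1 fps"
  assumes f0: "fps_nth f 0 = p * r" and bez: "\<alpha> * p + \<beta> * r = 1"
  obtains F G where "f = F * G" "fps_nth F 0 = p" "fps_nth G 0 = r"
proof -
  define good where "good i FG \<longleftrightarrow> fps_X ^ Suc i dvd f - fst FG * snd FG \<and>
     fps_nth (fst FG) 0 = p \<and> fps_nth (snd FG) 0 = r" for i and FG :: "'a fps \<times> 'a fps"
  have "\<exists>s. \<forall>i. good i (s i) \<and>
     fps_X ^ Suc i dvd fst (s (Suc i)) - fst (s i) \<and> fps_X ^ Suc i dvd snd (s (Suc i)) - snd (s i)"
  proof (rule dependent_nat_choice)
    show "\<exists>FG. good 0 FG"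
      by (rule exI[of _ "(fps_const p, fps_const r)"]) (simp add: good_def fps_X_dvd_iff f0)
  next
    fix FG i
    assume "good i FG"
    then obtain F G e where FG: "FG = (F, G)" and FG0: "fps_nth F 0 = p" "fps_nth G 0 = r"
      and e: "f - F * G = fps_X ^ Suc i * e"
      by (cases FG) (auto simp: good_def elim!: dvdE)
    define F' where "F' = F + fps_X ^ Suc i * (fps_const \<beta> * e)"
    define G' where "G' = G + fps_X ^ Suc i * (fps_const \<alpha> * e)"
    have "fps_X dvd 1 - fps_const \<alpha> * F - fps_const \<beta> * G"
      using bez by (simp add: fps_X_dvd_iff FG0 algebra_simps)
    then obtain d where d: "1 - fps_const \<alpha> * F - fps_const \<beta> * G = fps_X * d" ..
    have "f - F' * G' = (f - F * G) - fps_X ^ Suc i * e * (fps_const \<alpha> * F + fps_const \<beta> * G)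
       - fps_X ^ Suc i * fps_X ^ Suc i * (fps_const \<alpha> * fps_const \<beta> * e * e)"
      unfolding F'_def G'_def by (simp only: algebra_simps)
    also have "\<dots> = fps_X ^ Suc i * e * (1 - fps_const \<alpha> * F - fps_const \<beta> * G)
       - fps_X ^ Suc i * fps_X ^ Suc i * (fps_const \<alpha> * fps_const \<beta> * e * e)"
      unfolding e by (simp only: algebra_simps mult_1)
    also have "\<dots> = fps_X ^ Suc (Suc i) * (e * d - fps_X ^ i * (fps_const \<alpha> * fps_const \<beta> * e * e))"
      unfolding d by (simp add: algebra_simps)
    finally have "fps_X ^ Suc (Suc i) dvd f - F' * G'" by (rule dvdI)
    then show "\<exists>FG'. good (Suc i) FG' \<and> fps_X ^ Suc i dvd fst FG' - fst FG \<and>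
        fps_X ^ Suc i dvd snd FG' - snd FG"
      by (intro exI[of _ "(F', G')"]) (auto simp: good_def FG F'_def G'_def FG0)
  qed
  then obtain s where s: "\<And>i. good i (s i)"
    and s1: "\<And>i. fps_X ^ Suc i dvd fst (s (Suc i)) - fst (s i)"
    and s2: "\<And>i. fps_X ^ Suc i dvd snd (s (Suc i)) - snd (s i)" by blast
  have le: "fps_X ^ i dvd (p :: 'a fps)" if "fps_X ^ Suc i dvd p" for i p
    using that by (rule dvd_trans[rotated]) simp
  obtain F where F: "\<And>i. fps_X ^ i dvd F - fst (s i)"
    by (rule fps_X_adic_limit[of "\<lambda>i. fst (s i)", OF le[OF s1]]) blast
  obtain G where G: "\<And>i. fps_X ^ i dvd G - snd (s i)"
    by (rule fps_X_adic_limit[of "\<lambda>i. snd (s i)", OF le[OF s2]]) blast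
  have "fps_X ^ i dvd f - F * G" for i
  proof -
    have "fps_X ^ i dvd f - fst (s i) * snd (s i)"
      using s[of i] unfolding good_def by (blast intro: le)
    moreover have "fps_X ^ i dvd (F - fst (s i)) * G + fst (s i) * (G - snd (s i))"
      using F[of i] G[of i] by simp
    ultimately have "fps_X ^ i dvd (f - fst (s i) * snd (s i)) -
        ((F - fst (s i)) * G + fst (s i) * (G - snd (s i)))" by (rule dvd_diff)
    then show ?thesis by (simp add: algebra_simps)
  qed
  then have "f - F * G = 0" by (rule fps_X_adic_separated)
  moreover have "fps_nth F 0 = p" "fps_nth G 0 = r"
    using F[of 1] G[of 1] s[of 1] by (auto simp: fps_X_dvd_iff good_def)
  ultimately show thesis by (intro that) auto
qed

text \<open>
  Some \<open>1 - \<gamma> r\<close> vanishes at \<open>a\<close>, hence is divisible by \<open>x - a\<close>; its \<open>n\<close>th power is divisible by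
  \<open>(x - a)\<^sup>n\<close> and is still congruent to \<open>1\<close> modulo \<open>r\<close>.
\<close>

lemma bezout_linear_power:
  fixes r :: "'k::field poly"
  assumes "poly r a \<noteq> 0"
  obtains \<alpha> \<beta> where "\<alpha> * [:- a, 1:] ^ n + \<beta> * r = 1"
proof -
  let ?w = "1 - [:inverse (poly r a):] * r"
  have "[:- a, 1:] dvd ?w" using assms by (simp flip: poly_eq_0_iff_dvd)
  then have "[:- a, 1:] ^ n dvd ?w ^ n" by (rule dvd_power_same)
  then obtain \<alpha> where \<alpha>: "?w ^ n = [:- a, 1:] ^ n * \<alpha>" ..
  have "r dvd 1 - ?w" by (simp add: dvd_smult)
  also have "1 - ?w dvd 1 ^ n - ?w ^ n"
    unfolding power_diff_sumr2 by (rule dvd_triv_left)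
  finally obtain \<beta> where "1 ^ n - ?w ^ n = r * \<beta>" ..
  then have "\<alpha> * [:- a, 1:] ^ n + \<beta> * r = 1" using \<alpha> by (simp add: algebra_simps)
  then show thesis by (rule that)
qed

text \<open>
  Two distinct roots of \<open>f(x,0)\<close> would split it into coprime factors, which lift to a factorization
  of \<open>f\<close>.
\<close>

lemma irreducible_constant_coefficient:
  fixes f :: "'k::alg_closed_field poly fps"
  assumes irr: "Factorial_Ring.irreducible f" and y: "\<not> fps_X dvd f"
  obtains c a n where "c \<noteq> 0" "n > 0" "fps_nth f 0 = smult c ([:- a, 1:] ^ n)"
proof -
  let ?p = "fps_nth f 0"
  have p0: "?p \<noteq> 0" using y by (simp add: fps_X_dvd_iff)
  have "\<not> ?p dvd 1"
    using irr by (auto simp: Factorial_Ring.irreducible_def fps_dvd_one_iff)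
  then have "degree ?p > 0" using p0 by (simp add: is_unit_iff_degree)
  then obtain a where a: "poly ?p a = 0" using alg_closed_imp_poly_has_root by blast
  define n where "n = order a ?p"
  have n: "n > 0" using a p0 by (simp add: n_def order_root)
  obtain r where r: "?p = [:- a, 1:] ^ n * r" and ra: "\<not> [:- a, 1:] dvd r"
    using order_decomp[OF p0, of a] unfolding n_def by blast
  have "poly r a \<noteq> 0" using ra by (simp add: poly_eq_0_iff_dvd)
  then obtain \<alpha> \<beta> where "\<alpha> * [:- a, 1:] ^ n + \<beta> * r = 1" by (rule bezout_linear_power)
  with r obtain F G where FG: "f = F * G" "fps_nth F 0 = [:- a, 1:] ^ n" "fps_nth G 0 = r"
    by (rule hensel_factorization)
  have "\<not> F dvd 1" using n by (simp add: fps_dvd_one_iff FG is_unit_iff_degree degree_linear_power)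
  with irr FG(1) have "G dvd 1" by (auto simp: Factorial_Ring.irreducible_def)
  then have "r dvd 1" by (simp add: fps_dvd_one_iff FG)
  then obtain c where "r = [:c:]" "c \<noteq> 0" by (auto simp: is_unit_poly_iff dvd_field_iff)
  then show thesis using n r by (intro that[of c n a]) auto
qed

section \<open>Local algebra at a point\<close>

text \<open>
  Modulo \<open>f\<close>, the powers of the maximal ideal of the point and the powers of \<open>y\<close> define the same
  topology; this is the nontrivial half of that comparison.
\<close>

lemma at_point_power_mod:
  fixes f p :: "'k::field poly fps"
  assumes f0: "fps_nth f 0 = smult c ([:- a, 1:] ^ n)" and "c \<noteq> 0" and p: "at_point a p = 0"
  obtains u r where "p ^ n = f * u + fps_X * r"
proof (rule dvd_fps_X_mod_obtain)
  have "[:- a, 1:] dvd fps_nth p 0" using p by (simp add: at_point_def poly_eq_0_iff_dvd)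
  then have "[:- a, 1:] ^ n dvd fps_nth (p ^ n) 0"
    by (simp add: fps_power_zeroth dvd_power_same)
  then show "fps_nth f 0 dvd fps_nth (p ^ n) 0" using \<open>c \<noteq> 0\<close> by (simp add: f0 smult_dvd_iff)
qed (rule that)

text \<open>
  \<open>A/(f)\<close> is a local ring: a Bezout relation between \<open>u(x,0)\<close> and \<open>(x - a)\<^sup>n\<close> gives an element of
  \<open>(f,u)\<close> with constant coefficient \<open>1\<close>, and such a series is a unit.
\<close>

lemma unit_mod_if_nonzero_at_point:
  fixes f u :: "'k::field poly fps"
  assumes f0: "fps_nth f 0 = smult c ([:- a, 1:] ^ n)" and c: "c \<noteq> 0" and u: "at_point a u \<noteq> 0"
  obtains v where "f dvd u * v - 1"
proof -
  from u obtain \<alpha> \<beta> where ab: "\<alpha> * [:- a, 1:] ^ n + \<beta> * fps_nth u 0 = 1"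
    unfolding at_point_def by (rule bezout_linear_power)
  define s where "s = fps_const (\<alpha> * [:inverse c:])"
  define e where "e = s * f + fps_const \<beta> * u"
  have "fps_nth e 0 = 1" using ab c by (simp add: e_def s_def f0)
  then have "e dvd 1" by (simp add: fps_dvd_one_iff)
  then obtain w where w: "1 = e * w" ..
  have "u * (fps_const \<beta> * w) - 1 = f * (- s * w)"
    unfolding w e_def by (simp add: algebra_simps)
  then show thesis using that by (metis dvd_triv_left)
qed

lemma power_add_second_order:
  fixes z d :: "'a::comm_ring_1"
  obtains r where "(z + d) ^ Suc m = z ^ Suc m + of_nat (Suc m) * z ^ m * d + d * d * r"
proof (induction m arbitrary: thesis)
  case 0
  show ?case by (rule 0[of 0]) simp
next
  case (Suc m)
  obtain r where r: "(z + d) ^ Suc m = z ^ Suc m + of_nat (Suc m) * z ^ m * d + d * d * r"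
    by (rule Suc.IH)
  have "(z + d) ^ Suc (Suc m) = (z + d) * (z ^ Suc m + of_nat (Suc m) * z ^ m * d + d * d * r)"
    unfolding r[symmetric] by (rule power_Suc)
  also have "\<dots> = z ^ Suc (Suc m) + of_nat (Suc (Suc m)) * z ^ Suc m * d
      + d * d * (z * r + of_nat (Suc m) * z ^ m + d * r)"
    by (simp add: algebra_simps)
  finally show ?case by (rule Suc.prems)
qed

text \<open>
  One step of Newton's method for \<open>z\<^sup>q = w\<close> in the local ring \<open>A/(f)\<close>, where the derivative
  \<open>q z\<^sup>q\<^sup>-\<^sup>1\<close> is a unit. The error \<open>e\<close> is replaced by a multiple of \<open>e\<^sup>2\<close>.
\<close>

lemma newton_step:
  fixes f w z e :: "'k::field poly fps"
  assumes f0: "fps_nth f 0 = smult c ([:- a, 1:] ^ n)" and c: "c \<noteq> 0"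
    and q: "q > 0" "of_nat q \<noteq> (0 :: 'k)" and z: "at_point a z \<noteq> 0"
    and e: "f dvd w - z ^ q - e"
  obtains z' e' where "e dvd z' - z" "e * e dvd e'" "f dvd w - z' ^ q - e'"
proof -
  obtain m where m: "q = Suc m" using q(1) by (cases q) auto
  have "at_point a (of_nat q * z ^ m) \<noteq> 0" using q(2) z by simp
  with f0 c obtain v where v: "f dvd of_nat q * z ^ m * v - 1"
    by (rule unit_mod_if_nonzero_at_point)
  obtain r where r: "(z + e * v) ^ q = z ^ q + of_nat q * z ^ m * (e * v) + e * v * (e * v) * r"
    unfolding m by (rule power_add_second_order)
  have "f dvd (w - z ^ q - e) - e * (of_nat q * z ^ m * v - 1)"
    using e v by simp
  also have "\<dots> = w - (z + e * v) ^ q - e * e * (- v * v * r)"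
    unfolding r by (simp add: algebra_simps)
  finally have "f dvd w - (z + e * v) ^ q - e * e * (- v * v * r)" .
  then show thesis by (rule that[rotated 2]) simp_all
qed

text \<open>
  Hensel's lemma for the polynomial \<open>Z\<^sup>q - w\<close>. Newton's method starts from a root in the residue
  field. In its first phase the error is a high power of an element of the maximal ideal, until
  it is divisible by \<open>y\<close> modulo \<open>f\<close>; in the second phase it is \<open>y\<close>-adically small and the iterates
  converge.
\<close>

lemma root_mod_if_nonzero_at_point:
  fixes f w :: "'k::alg_closed_field poly fps"
  assumes f0: "fps_nth f 0 = smult c ([:- a, 1:] ^ n)" and c: "c \<noteq> 0"
    and q: "q > 0" "of_nat q \<noteq> (0 :: 'k)" and w: "at_point a w \<noteq> 0"
  obtains z where "f dvd w - z ^ q"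
proof -
  have ndvd: "\<not> fps_X dvd f" using c by (simp add: fps_X_dvd_iff f0)
  obtain \<zeta> where \<zeta>: "\<zeta> ^ q = at_point a w" using nth_root_exists q(1) by blast
  define e0 where "e0 = w - fps_const [:\<zeta>:] ^ q"
  have e0: "at_point a e0 = 0" by (simp add: e0_def \<zeta>)
  have "\<exists>z e. at_point a z \<noteq> 0 \<and> e0 ^ Suc k dvd e \<and> f dvd w - z ^ q - e" for k
  proof (induction k)
    case 0
    have "\<zeta> \<noteq> 0" using \<zeta> w q(1) by (metis power_eq_0_iff)
    then show ?case
      by (intro exI[of _ "fps_const [:\<zeta>:]"] exI[of _ e0]) (simp add: e0_def)
  next
    case (Suc k)
    then obtain z e where z: "at_point a z \<noteq> 0" and e: "e0 ^ Suc k dvd e"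
      and fe: "f dvd w - z ^ q - e" by blast
    obtain z' e' where *: "e dvd z' - z" "e * e dvd e'" "f dvd w - z' ^ q - e'"
      by (rule newton_step[OF f0 c q z fe])
    have "e0 dvd z' - z" using e *(1) by (meson dvd_power dvd_trans zero_less_Suc)
    then have "at_point a z' \<noteq> 0" using z at_point_dvd[OF _ e0, of "z' - z"] by simp
    moreover have "e0 ^ Suc (Suc k) dvd e0 ^ Suc k * e0 ^ Suc k"
      unfolding power_add[symmetric] by (rule le_imp_power_dvd) simp
    then have "e0 ^ Suc (Suc k) dvd e'"
      using mult_dvd_mono[OF e e] *(2) by (meson dvd_trans)
    ultimately show ?case using *(3) by blast
  qed
  then obtain z1 e1 where z1: "at_point a z1 \<noteq> 0" and e1: "e0 ^ Suc n dvd e1"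
    and fe1: "f dvd w - z1 ^ q - e1" by blast
  define good where "good i z \<longleftrightarrow> at_point a z \<noteq> 0 \<and>
     (\<exists>e. fps_X ^ Suc i dvd e \<and> f dvd w - z ^ q - e)" for i :: nat and z
  have "\<exists>s. \<forall>i. good i (s i) \<and> fps_X ^ Suc i dvd s (Suc i) - s i"
  proof (rule dependent_nat_choice)
    obtain u r where ur: "e0 ^ n = f * u + fps_X * r" by (rule at_point_power_mod[OF f0 c e0])
    from e1 obtain d where d: "e1 = e0 ^ Suc n * d" ..
    have "e1 = fps_X * (r * e0 * d) + f * (u * e0 * d)"
      unfolding d power_Suc2 ur by (simp add: algebra_simps)
    then have "w - z1 ^ q - fps_X * (r * e0 * d) = (w - z1 ^ q - e1) + f * (u * e0 * d)" by simp
    also have "f dvd \<dots>" using fe1 by simp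
    finally show "\<exists>z. good 0 z"
      using z1 unfolding good_def
      by (intro exI[of _ z1] conjI exI[of _ "fps_X * (r * e0 * d)"]) simp_all
  next
    fix z i
    assume "good i z"
    then obtain e where z: "at_point a z \<noteq> 0" and e: "fps_X ^ Suc i dvd e"
      and fe: "f dvd w - z ^ q - e" by (auto simp: good_def)
    obtain z' e' where *: "e dvd z' - z" "e * e dvd e'" "f dvd w - z' ^ q - e'"
      by (rule newton_step[OF f0 c q z fe])
    have zz: "fps_X ^ Suc i dvd z' - z" using e *(1) by (rule dvd_trans)
    then have "at_point a (z' - z) = 0" by (rule at_point_dvd) simp
    moreover have "fps_X ^ Suc (Suc i) dvd (fps_X :: 'k poly fps) ^ Suc i * fps_X ^ Suc i"
      unfolding power_add[symmetric] by (rule le_imp_power_dvd) simp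
    then have "fps_X ^ Suc (Suc i) dvd e'"
      using mult_dvd_mono[OF e e] *(2) by (meson dvd_trans)
    ultimately show "\<exists>z'. good (Suc i) z' \<and> fps_X ^ Suc i dvd z' - z"
      using z zz *(3) by (intro exI[of _ z']) (auto simp: good_def)
  qed
  then obtain s where s: "\<And>i. good i (s i)" "\<And>i. fps_X ^ Suc i dvd s (Suc i) - s i" by blast
  have le: "fps_X ^ i dvd p" if "fps_X ^ Suc i dvd p" for i and p :: "'k poly fps"
    using that by (rule dvd_trans[rotated]) simp
  obtain l where l: "\<And>i. fps_X ^ i dvd l - s i"
    by (rule fps_X_adic_limit[of s, OF le[OF s(2)]]) blast
  have "f dvd w - l ^ q"
  proof (rule principal_ideal_closed[OF ndvd])
    fix i
    from s(1)[of i] obtain e u where e: "fps_X ^ Suc i dvd e" and u: "w - s i ^ q - e = f * u"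
      unfolding good_def by (blast elim: dvdE)
    have "l - s i dvd l ^ q - s i ^ q"
      unfolding power_diff_sumr2 by (rule dvd_triv_left)
    with l[of i] have "fps_X ^ i dvd l ^ q - s i ^ q" by (rule dvd_trans)
    with le[OF e] have "fps_X ^ i dvd e - (l ^ q - s i ^ q)" by (rule dvd_diff)
    moreover have "e - (l ^ q - s i ^ q) = w - l ^ q - f * u"
      unfolding u[symmetric] by (simp add: algebra_simps)
    ultimately show "\<exists>u. fps_X ^ i dvd w - l ^ q - f * u" by metis
  qed
  then show thesis by (rule that)
qed

section \<open>Contact with a curve that has a local parameter\<close>

lemma dvd_diff_obtain:
  fixes f :: "'a::comm_ring_1"
  assumes "f dvd p - r"
  obtains s where "p = r + f * s"
  using assms by (metis add_diff_cancel_left' diff_add_cancel dvdE add.commute)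

text \<open>
  The curve \<open>f = 0\<close> passes through \<open>(a,0)\<close>, and \<open>t\<close> generates the maximal ideal of that point modulo
  \<open>f\<close> and is not a zero divisor there. This covers a discrete valuation ring \<open>A/(f)\<close> with uniformizer
  \<open>t\<close> as well as \<open>A/(f) = k[x]\<close> with \<open>t = x - a\<close>, where elements outside the maximal ideal need not be
  units.
\<close>

locale local_parameter =
  fixes f t :: "'k::field poly fps" and a :: 'k
  assumes on_curve: "at_point a f = 0" and vanishes: "at_point a t = 0"
    and generates: "at_point a p = 0 \<Longrightarrow> \<exists>b. f dvd p - t * b"
    and regular: "f dvd t * z \<Longrightarrow> f dvd z"
begin

lemma regular_power: "f dvd t ^ i * z \<Longrightarrow> f dvd z"
  by (induction i) (auto simp: mult.assoc dest: regular)

lemma exponent_le: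
  assumes w: "at_point a w \<noteq> 0" and d: "f dvd t ^ i * w - t ^ j * b"
  shows "j \<le> i"
proof (rule ccontr)
  assume "\<not> j \<le> i"
  then obtain k where j: "j = i + Suc k" using less_imp_Suc_add by fastforce
  have "f dvd t ^ i * (w - t * (t ^ k * b))"
    using d by (simp add: j power_add algebra_simps)
  then have "f dvd w - t * (t ^ k * b)" by (rule regular_power)
  from at_point_dvd[OF this on_curve] w vanishes show False by simp
qed

lemma order_cases:
  obtains (high) b where "f dvd p - t ^ m * b"
  | (exact) l w where "l < m" "at_point a w \<noteq> 0" "f dvd p - t ^ l * w"
proof (induction m arbitrary: thesis)
  case 0
  show ?case by (rule 0(1)[of p]) simp
next
  case (Suc m)
  show ?case
  proof (rule Suc.IH)
    fix b assume b: "f dvd p - t ^ m * b"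
    show ?thesis
    proof (cases "at_point a b = 0")
      case True
      from generates[OF this] obtain b' where "f dvd b - t * b'" ..
      with b have "f dvd (p - t ^ m * b) + t ^ m * (b - t * b')" by simp
      then show ?thesis by (intro Suc.prems(1)[of b']) (simp add: algebra_simps)
    qed (use b in \<open>auto intro: Suc.prems(2)[of m b]\<close>)
  qed (auto intro: Suc.prems(2) less_SucI)
qed

text \<open>
  The order \<open>m\<close> of \<open>g\<close> along \<open>f\<close> is the intersection number of the two curves. Let \<open>l < m\<close> be the order
  of \<open>h\<close> (if it is at least \<open>m\<close>, then \<open>h\<close> lies in \<open>J = (f,g)\<close> and \<open>m = 0\<close>). As \<open>t\<^sup>m\<^sup>-\<^sup>l h\<close> lies in
  \<open>J = (g,h\<^sup>q)\<close> and \<open>h\<close> can be cancelled modulo \<open>g\<close>, also \<open>t\<^sup>m\<^sup>-\<^sup>l\<close> lies in \<open>(g,h\<^sup>q\<^sup>-\<^sup>1)\<close>, which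
  forces \<open>m - l \<ge> (q - 1) l\<close>. Conversely \<open>h\<^sup>q\<close> lies in \<open>J = (f,t\<^sup>m)\<close>, so \<open>q l \<ge> m\<close>.
\<close>

lemma exponent_dvd_order:
  assumes g: "f dvd g - t ^ m * w" and w: "at_point a w \<noteq> 0" and w_unit: "f dvd w * v - 1"
    and fh: "g dvd f - h ^ q" and q: "q > 1"
    and h_regular: "\<And>z. g dvd h * z \<Longrightarrow> g dvd z"
  shows "q dvd m"
proof -
  \<comment> \<open>The equations modulo \<open>f\<close> and \<open>g\<close> are kept in the form \<open>\<dots> = 0\<close>: each membership in an ideal
    then follows from an explicit linear combination of them.\<close>
  obtain p where q': "q = Suc (Suc p)" using q by (metis Suc_lessD less_imp_Suc_add add_Suc One_nat_def plus_1_eq_Suc)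
  from fh obtain s where "f - h ^ q = g * s" ..
  then have s: "f = h * h ^ Suc p + g * s" by (simp add: q' algebra_simps)
  from g obtain x where x: "g = t ^ m * w + f * x" by (rule dvd_diff_obtain)
  from w_unit obtain y where y: "w * v = 1 + f * y" by (rule dvd_diff_obtain)
  define T where "T = t ^ m"
  have x0: "g - T * w - f * x = 0" unfolding T_def x by (simp add: algebra_simps)
  have y0: "1 + f * y - w * v = 0" unfolding y by (simp add: algebra_simps)
  have s0: "f - h * h ^ Suc p - g * s = 0" using s by (simp only: algebra_simps) simp
  have "T - g * v + f * (x * v + T * y) = T * (1 + f * y - w * v) - v * (g - T * w - f * x)"
    by (simp add: algebra_simps)
  then have T0: "T - g * v + f * (x * v + T * y) = 0" by (simp only: x0 y0) simp
  \<comment> \<open>\<open>((f,g) : h)\<close> is contained in \<open>(g,h\<^sup>q\<^sup>-\<^sup>1)\<close>\<close>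
  have colon: "\<exists>\<alpha> \<beta>. z = h ^ Suc p * \<alpha> + g * \<beta>" if "h * z = f * \<alpha> + g * \<beta>" for z \<alpha> \<beta>
  proof -
    have "h * (z - h ^ Suc p * \<alpha>) - g * (\<beta> + s * \<alpha>)
        = (h * z - f * \<alpha> - g * \<beta>) + \<alpha> * (f - h * h ^ Suc p - g * s)"
      by (simp add: algebra_simps)
    also have "\<dots> = 0" using that by (simp only: s0) simp
    finally have "h * (z - h ^ Suc p * \<alpha>) = g * (\<beta> + s * \<alpha>)" by simp
    then have "g dvd h * (z - h ^ Suc p * \<alpha>)" by (rule dvdI)
    then have "g dvd z - h ^ Suc p * \<alpha>" by (rule h_regular)
    then obtain \<beta>' where "z - h ^ Suc p * \<alpha> = g * \<beta>'" ..
    then have "z = h ^ Suc p * \<alpha> + g * \<beta>'" by (simp add: algebra_simps)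
    then show ?thesis by blast
  qed
  have g_at: "at_point a g = 0" if "m > 0"
    unfolding x using that on_curve vanishes by simp
  show ?thesis
  proof (rule order_cases[of h m])
    fix b assume high: "f dvd h - t ^ m * b"
    have "m = 0"
    proof (rule ccontr)
      assume "m \<noteq> 0"
      from high obtain d where "h = t ^ m * b + f * d" by (rule dvd_diff_obtain)
      then have h0: "h - T * b - f * d = 0" by (simp add: T_def)
      have "h * 1 - (f * (d - b * (x * v + T * y)) + g * (v * b))
          = (h - T * b - f * d) + b * (T - g * v + f * (x * v + T * y))"
        by (simp add: algebra_simps)
      also have "\<dots> = 0" by (simp only: h0 T0) simp
      finally have h: "h * 1 = f * (d - b * (x * v + T * y)) + g * (v * b)" by simp
      from colon[OF h] obtain \<alpha> \<beta> where "1 = h ^ Suc p * \<alpha> + g * \<beta>" by blast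
      then have "at_point a 1 = at_point a (h ^ Suc p * \<alpha> + g * \<beta>)" by simp
      moreover have "at_point a h = 0" using h on_curve g_at \<open>m \<noteq> 0\<close> 
        by (metis add_0 at_point_simps(4,7) mult.right_neutral mult_zero_left not_gr_zero)
      ultimately show False using g_at \<open>m \<noteq> 0\<close> by simp
    qed
    then show ?thesis by simp
  next
    fix l u assume exact: "l < m" "at_point a u \<noteq> 0" "f dvd h - t ^ l * u"
    then obtain i where m: "m = l + i" and "i > 0" using less_imp_add_positive by blast
    from exact(3) obtain d where h: "h = t ^ l * u + f * d" by (rule dvd_diff_obtain)
    have "l > 0"
    proof (rule ccontr)
      assume "\<not> l > 0"
      then have "at_point a h \<noteq> 0" using h exact(2) on_curve by simp
      moreover have "at_point a f = at_point a (h * h ^ Suc p + g * s)" using s by simp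
      ultimately show False using on_curve g_at \<open>l < m\<close> by simp
    qed
    have "h - t ^ l * u dvd h ^ k - (t ^ l * u) ^ k" for k
      unfolding power_diff_sumr2 by (rule dvd_triv_left)
    with exact(3) have hk: "f dvd h ^ k - (t ^ l * u) ^ k" for k by (rule dvd_trans)
    \<comment> \<open>otherwise \<open>t\<^sup>i\<close> with \<open>i = m - l\<close> would be a multiple of \<open>t\<^sup>i\<^sup>+\<^sup>1\<close> modulo \<open>f\<close>\<close>
    have "l * Suc p \<le> i"
    proof (rule ccontr)
      assume "\<not> l * Suc p \<le> i"
      then obtain j where j: "l * Suc p = Suc i + j" by (metis add_Suc less_imp_Suc_add not_le)
      obtain j' where j': "m = Suc i + j'" using m \<open>l > 0\<close> by (metis add.commute add_Suc gr0_conv_Suc)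
      have h0: "h - t ^ l * u - f * d = 0" using h by simp
      have T: "T - t ^ l * t ^ i = 0" by (simp add: T_def m power_add)
      have "h * t ^ i - (f * (d * t ^ i - u * (x * v + T * y)) + g * (v * u))
          = t ^ i * (h - t ^ l * u - f * d) + u * (T - g * v + f * (x * v + T * y))
            - u * (T - t ^ l * t ^ i)"
        by (simp add: algebra_simps)
      also have "\<dots> = 0" by (simp only: h0 T0 T) simp
      finally have "h * t ^ i = f * (d * t ^ i - u * (x * v + T * y)) + g * (v * u)" by simp
      from colon[OF this] obtain \<alpha> \<beta> where "t ^ i = h ^ Suc p * \<alpha> + g * \<beta>" by blast
      then have i0: "t ^ i - h ^ Suc p * \<alpha> - g * \<beta> = 0" by simp
      obtain r where "h ^ Suc p - (t ^ l * u) ^ Suc p = f * r" using hk[of "Suc p"] ..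
      moreover have "(t ^ l * u) ^ Suc p = t ^ Suc i * (t ^ j * u ^ Suc p)"
        by (simp only: power_mult_distrib power_mult[symmetric] j power_add mult.assoc)
      ultimately have r0: "h ^ Suc p - t ^ Suc i * (t ^ j * u ^ Suc p) - f * r = 0" by (simp only: diff_self)
      have j0: "T - t ^ Suc i * t ^ j' = 0" by (simp add: T_def j' power_add)
      have "t ^ i - t ^ Suc i * (t ^ j * u ^ Suc p * \<alpha> + t ^ j' * w * \<beta>) - f * (r * \<alpha> + x * \<beta>)
          = (t ^ i - h ^ Suc p * \<alpha> - g * \<beta>)
            + \<alpha> * (h ^ Suc p - t ^ Suc i * (t ^ j * u ^ Suc p) - f * r)
            + \<beta> * (g - T * w - f * x) + w * \<beta> * (T - t ^ Suc i * t ^ j')"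
        by (simp add: algebra_simps)
      also have "\<dots> = 0" by (simp only: i0 r0 x0 j0) simp
      finally have "t ^ i - t ^ Suc i * (t ^ j * u ^ Suc p * \<alpha> + t ^ j' * w * \<beta>)
          = f * (r * \<alpha> + x * \<beta>)" by simp
      then have "f dvd t ^ i * 1 - t ^ Suc i * (t ^ j * u ^ Suc p * \<alpha> + t ^ j' * w * \<beta>)" by simp
      from exponent_le[OF _ this] show False by simp
    qed
    moreover have "m \<le> l * q"
    proof (rule exponent_le)
      show "at_point a (u ^ q) \<noteq> 0" using exact(2) by simp
      obtain r where "h ^ q - (t ^ l * u) ^ q = f * r" using hk[of q] ..
      moreover have "(t ^ l * u) ^ q = t ^ (l * q) * u ^ q"
        by (simp only: power_mult_distrib power_mult)
      ultimately have r0: "h ^ q - t ^ (l * q) * u ^ q - f * r = 0" by (simp only: diff_self)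
      have s0': "f - h ^ q - g * s = 0" using s0 by (simp only: q' power_Suc)
      have "t ^ (l * q) * u ^ q - t ^ m * (- w * s) - f * (1 - x * s - r)
          = - (h ^ q - t ^ (l * q) * u ^ q - f * r) - (f - h ^ q - g * s) - s * (g - T * w - f * x)"
        by (simp add: algebra_simps T_def)
      also have "\<dots> = 0" by (simp only: r0 s0' x0) simp
      finally have "t ^ (l * q) * u ^ q - t ^ m * (- w * s) = f * (1 - x * s - r)" by simp
      then show "f dvd t ^ (l * q) * u ^ q - t ^ m * (- w * s)" by simp
    qed
    ultimately have "m = l * q" by (simp add: q' m)
    then show ?thesis by simp
  qed
qed

end

section \<open>Prime ideals through a curve\<close>

abbreviation (input) series_ring :: "'k::field poly fps ring" where
  "series_ring \<equiv> ring_of_type_algebra"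

lemma series_ring_simps [simp]:
  "carrier (ring_of_type_algebra :: 'a::comm_ring_1 ring) = UNIV"
  "x \<otimes>\<^bsub>ring_of_type_algebra\<^esub> y = (x * y :: 'a)"
  "x \<oplus>\<^bsub>ring_of_type_algebra\<^esub> y = (x + y :: 'a)"
  "\<one>\<^bsub>ring_of_type_algebra\<^esub> = (1 :: 'a)"
  "\<zero>\<^bsub>ring_of_type_algebra\<^esub> = (0 :: 'a)"
  by (simp_all add: ring_of_type_algebra_def)

lemma primeideal_type_algebraD:
  fixes Q :: "'a::comm_ring_1 set"
  assumes "primeideal Q ring_of_type_algebra"
  shows "0 \<in> Q" "p \<in> Q \<Longrightarrow> r \<in> Q \<Longrightarrow> p + r \<in> Q" "p \<in> Q \<Longrightarrow> r \<in> Q \<Longrightarrow> p - r \<in> Q"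
    "p \<in> Q \<Longrightarrow> r * p \<in> Q" "p \<in> Q \<Longrightarrow> p * r \<in> Q" "1 \<notin> Q" "p * r \<in> Q \<Longrightarrow> p \<in> Q \<or> r \<in> Q"
proof -
  interpret primeideal Q ring_of_type_algebra by fact
  show "0 \<in> Q" using additive_subgroup.zero_closed[OF is_additive_subgroup] by simp
  show add: "p + r \<in> Q" if "p \<in> Q" "r \<in> Q" for p r
    using additive_subgroup.a_closed[OF is_additive_subgroup that] by simp
  show mult: "r * p \<in> Q" if "p \<in> Q" for p r using I_l_closed[OF that, of r] by simp
  then show "p * r \<in> Q" if "p \<in> Q" for p r using that by (simp add: mult.commute)
  show "p - r \<in> Q" if "p \<in> Q" "r \<in> Q" for p r
    using add[OF that(1) mult[OF that(2), of "- 1"]] by simp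
  show "1 \<notin> Q" using I_notcarr one_imp_carrier by auto
  show "p * r \<in> Q \<Longrightarrow> p \<in> Q \<or> r \<in> Q" for p r using I_prime[of p r] by simp
qed

lemma primeideal_type_algebra_power:
  fixes p :: "'a::comm_ring_1"
  assumes "primeideal Q ring_of_type_algebra" "p ^ n \<in> Q"
  shows "p \<in> Q"
  using assms(2) primeideal_type_algebraD(6,7)[OF assms(1)] by (induction n) auto

text \<open>
  Reducing \<open>Q\<close> modulo \<open>y\<close> gives an ideal of the principal ideal domain \<open>k[x]\<close>. A lift \<open>b\<close> of its
  generator, found here as an element whose constant coefficient has least degree, generates \<open>Q\<close>: subtract
  a multiple of \<open>b\<close> from an element of \<open>Q\<close>, divide the rest by \<open>y\<close>, which stays in the prime ideal
  \<open>Q\<close>, and iterate.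
\<close>

lemma prime_avoiding_fps_X_principal:
  fixes f :: "'k::field poly fps"
  assumes Q: "primeideal Q series_ring" and XQ: "fps_X \<notin> Q"
    and f: "f \<in> Q" "\<not> fps_X dvd f"
  obtains b where "b \<in> Q" "\<And>p. p \<in> Q \<Longrightarrow> b dvd p"
proof -
  note Qs = primeideal_type_algebraD[OF Q]
  obtain b where b: "b \<in> Q" "\<not> fps_X dvd b"
    and least: "\<And>p. p \<in> Q \<Longrightarrow> \<not> fps_X dvd p \<Longrightarrow> degree (fps_nth b 0) \<le> degree (fps_nth p 0)"
    using ex_has_least_nat[of "\<lambda>p. p \<in> Q \<and> \<not> fps_X dvd p" f "\<lambda>p. degree (fps_nth p 0)"] f by blast
  have b0: "fps_nth b 0 \<noteq> 0" using b by (simp add: fps_X_dvd_iff)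
  have step: "\<exists>s p'. p = b * s + fps_X * p' \<and> p' \<in> Q" if "p \<in> Q" for p
  proof -
    have "fps_nth b 0 dvd fps_nth p 0"
    proof (rule ccontr)
      assume nd: "\<not> fps_nth b 0 dvd fps_nth p 0"
      define r where "r = p - fps_const (fps_nth p 0 div fps_nth b 0) * b"
      have r0: "fps_nth r 0 = fps_nth p 0 mod fps_nth b 0"
        by (simp add: r_def minus_div_mult_eq_mod)
      have "r \<in> Q" unfolding r_def using that b(1) by (intro Qs)
      moreover have "fps_nth r 0 \<noteq> 0" using nd by (simp add: r0 mod_eq_0_iff_dvd)
      ultimately have "degree (fps_nth b 0) \<le> degree (fps_nth r 0)"
        by (intro least) (simp_all add: fps_X_dvd_iff)
      moreover have "degree (fps_nth r 0) < degree (fps_nth b 0)"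
        using degree_mod_less[OF b0, of "fps_nth p 0"] \<open>fps_nth r 0 \<noteq> 0\<close> by (simp add: r0)
      ultimately show False by simp
    qed
    then obtain s p' where p: "p = b * s + fps_X * p'" by (rule dvd_fps_X_mod_obtain)
    have "p - b * s \<in> Q" using that b(1) by (intro Qs)
    then have "fps_X * p' \<in> Q" by (simp add: p)
    then have "p' \<in> Q" using Qs(7) XQ by blast
    with p show ?thesis by blast
  qed
  have "\<exists>u p'. p = b * u + fps_X ^ i * p' \<and> p' \<in> Q" if "p \<in> Q" for p i
  proof (induction i)
    case (Suc i)
    then obtain u p' where u: "p = b * u + fps_X ^ i * p'" "p' \<in> Q" by blast
    from step[OF u(2)] obtain s p'' where s: "p' = b * s + fps_X * p''" "p'' \<in> Q" by blast
    have "p = b * (u + fps_X ^ i * s) + fps_X ^ Suc i * p''"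
      unfolding u(1) s(1) by (simp add: algebra_simps)
    with s(2) show ?case by blast
  next
    case 0
    show ?case using that by (intro exI[of _ 0] exI[of _ p]) simp
  qed
  then have "\<exists>u. fps_X ^ i dvd p - b * u" if "p \<in> Q" for p i
    using that by (metis add_diff_cancel_left' dvd_triv_left)
  then have "b dvd p" if "p \<in> Q" for p
    using that b(2) by (intro principal_ideal_closed)
  with b(1) show thesis by (rule that)
qed

text \<open>
  Otherwise both ideals would be principal primes, and a nonzero principal prime ideal \<open>(b)\<close> of a domain
  is not strictly contained in another one \<open>(b')\<close>: in \<open>b = b' s\<close> primality puts \<open>s\<close> in \<open>(b)\<close>, and
  cancelling \<open>b\<close> makes \<open>b'\<close> a unit.
\<close>

lemma no_prime_chain_avoiding_fps_X:
  fixes f :: "'k::field poly fps"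
  assumes Q: "primeideal Q series_ring" "primeideal Q' series_ring" "Q \<subset> Q'"
    and f: "f \<in> Q" "\<not> fps_X dvd f"
  shows "fps_X \<in> Q'"
proof (rule ccontr)
  assume X: "fps_X \<notin> Q'"
  note Qs = primeideal_type_algebraD[OF Q(1)] and Qs' = primeideal_type_algebraD[OF Q(2)]
  have "fps_X \<notin> Q" "f \<in> Q'" using X Q(3) f(1) by auto
  with Q f X obtain b b' where b: "b \<in> Q" "\<And>p. p \<in> Q \<Longrightarrow> b dvd p"
    and b': "b' \<in> Q'" "\<And>p. p \<in> Q' \<Longrightarrow> b' dvd p"
    using prime_avoiding_fps_X_principal by metis
  have "b' \<notin> Q"
  proof
    assume "b' \<in> Q"
    then have "Q' \<subseteq> Q" using b'(2) Qs(5) by (blast elim: dvdE)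
    with Q(3) show False by blast
  qed
  from b(1) Q(3) b'(2) obtain s where s: "b = b' * s" by (blast elim: dvdE)
  with b(1) \<open>b' \<notin> Q\<close> Qs(7) have "s \<in> Q" by blast
  then obtain s' where "s = b * s'" using b(2) by (blast elim: dvdE)
  with s have "b * (b' * s') = b * 1" by (simp add: mult_ac)
  moreover have "b \<noteq> 0" using b(2)[OF f(1)] f(2) by auto
  ultimately have "b' * s' = 1" by (subst (asm) mult_cancel_left) simp
  then show False using Qs'(5)[OF b'(1), of s'] Qs'(6) by simp
qed

text \<open>
  \<open>A/(f)\<close> has Krull dimension at most one. The middle ideal of the chain would contain \<open>f\<close> and \<open>y\<close>, hence
  everything that vanishes at \<open>(a,0)\<close>, so it would be maximal.
\<close>

lemma prime_chain_length:
  fixes f :: "'k::field poly fps"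
  assumes f0: "fps_nth f 0 = smult c ([:- a, 1:] ^ n)" and c: "c \<noteq> 0"
    and Q: "primeideal Q0 series_ring" "primeideal Q1 series_ring" "primeideal Q2 series_ring"
    and chain: "Q0 \<subset> Q1" "Q1 \<subset> Q2" and f: "f \<in> Q0"
  shows False
proof -
  note Qs1 = primeideal_type_algebraD[OF Q(2)] and Qs2 = primeideal_type_algebraD[OF Q(3)]
  have "\<not> fps_X dvd f" using c by (simp add: fps_X_dvd_iff f0)
  with Q(1,2) chain(1) f have X: "fps_X \<in> Q1" by (rule no_prime_chain_avoiding_fps_X)
  have vanishing: "p \<in> Q1" if p: "at_point a p = 0" for p
  proof -
    obtain u r where "p ^ n = f * u + fps_X * r" by (rule at_point_power_mod[OF f0 c p])
    moreover have "f * u + fps_X * r \<in> Q1" using X f chain(1) by (intro Qs1) auto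
    ultimately have "p ^ n \<in> Q1" by simp
    then show ?thesis by (rule primeideal_type_algebra_power[OF Q(2)])
  qed
  from chain(2) obtain p where p: "p \<in> Q2" "p \<notin> Q1" by blast
  with vanishing have "at_point a p \<noteq> 0" by blast
  with f0 c obtain v where "f dvd p * v - 1" by (rule unit_mod_if_nonzero_at_point)
  then obtain s where s: "p * v - 1 = f * s" ..
  have "f \<in> Q2" using f chain by blast
  then have "p * v - f * s \<in> Q2" using p(1) by (intro Qs2)
  then show False using Qs2(6) by (simp add: s[symmetric])
qed

section \<open>The local ring of the curve at a point\<close>

text \<open>
  The quotient ring enters the rest of the argument only through a surjection from \<open>A\<close> with kernel
  \<open>(f)\<close>, so that congruences become divisibility statements about series.
\<close>

lemma coordinate_ring_projection:
  fixes f :: "'k::field poly fps"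
  obtains \<pi> where "ring_hom_cring series_ring (coordinate_ring f) \<pi>"
    "carrier (coordinate_ring f) = range \<pi>" "\<And>p r. \<pi> p = \<pi> r \<longleftrightarrow> f dvd p - r"
proof -
  let ?R = "ring_of_type_algebra :: 'k poly fps ring"
  interpret R: cring ?R by (rule cring_from_type_algebra)
  let ?I = "PIdl\<^bsub>?R\<^esub> f"
  interpret I: ideal ?I ?R by (rule R.cgenideal_ideal) simp
  have mem: "p \<in> ?I \<longleftrightarrow> f dvd p" for p
    by (auto simp: cgenideal_def dvd_def mult.commute)
  have minus: "p \<ominus>\<^bsub>?R\<^esub> r = p - r" for p r
  proof -
    have "\<ominus>\<^bsub>?R\<^esub> r = - r" by (rule R.minus_equality) simp_all
    then show ?thesis by (simp add: a_minus_def)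
  qed
  show thesis
  proof (rule that)
    show "ring_hom_cring ?R (coordinate_ring f) ((+>\<^bsub>?R\<^esub>) ?I)"
      unfolding coordinate_ring_def by (rule I.rcos_ring_hom_cring[OF R.is_cring])
    show "carrier (coordinate_ring f) = range ((+>\<^bsub>?R\<^esub>) ?I)"
      by (auto simp: coordinate_ring_def FactRing_def A_RCOSETS_def')
    show "?I +>\<^bsub>?R\<^esub> p = ?I +>\<^bsub>?R\<^esub> r \<longleftrightarrow> f dvd p - r" for p r
      using R.quotient_eq_iff_same_a_r_cos[OF I.is_ideal, of p r] by (simp add: mem minus)
  qed
qed

text \<open>
  Localizing \<open>A/(f)\<close> at the ideal of the point \<open>(a,0)\<close> changes nothing, because elements outside this ideal
  are already units. The local ring is therefore again the image of \<open>A\<close> under a homomorphism with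
  kernel \<open>(f)\<close>.
\<close>

lemma local_ring_presentation:
  fixes f :: "'k::field poly fps"
  assumes f0: "fps_nth f 0 = smult c ([:- a, 1:] ^ n)" and c: "c \<noteq> 0" and n: "n > 0"
  obtains P \<phi> where "primeideal P (coordinate_ring f)"
    "ring_hom_cring series_ring (local_ring_at (coordinate_ring f) P) \<phi>"
    "carrier (local_ring_at (coordinate_ring f) P) = range \<phi>"
    "\<And>p r. \<phi> p = \<phi> r \<longleftrightarrow> f dvd p - r"
proof -
  let ?R = "ring_of_type_algebra :: 'k poly fps ring" and ?B = "coordinate_ring f"
  obtain \<pi> where hom: "ring_hom_cring ?R ?B \<pi>" and surj: "carrier ?B = range \<pi>"
    and ker: "\<And>p r. \<pi> p = \<pi> r \<longleftrightarrow> f dvd p - r" using coordinate_ring_projection[of f] by blast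
  interpret \<pi>: ring_hom_cring ?R ?B \<pi> by (rule hom)
  have \<pi>_simps: "\<pi> p \<otimes>\<^bsub>?B\<^esub> \<pi> r = \<pi> (p * r)" "\<pi> p \<oplus>\<^bsub>?B\<^esub> \<pi> r = \<pi> (p + r)"
    "\<one>\<^bsub>?B\<^esub> = \<pi> 1" "\<zero>\<^bsub>?B\<^esub> = \<pi> 0" for p r
    using \<pi>.hom_mult[of p r] \<pi>.hom_add[of p r] \<pi>.hom_one \<pi>.hom_zero by simp_all
  have f_at: "at_point a f = 0" using n by (simp add: at_point_def f0)
  define P where "P = \<pi> ` {p. at_point a p = 0}"
  have P: "\<pi> p \<in> P \<longleftrightarrow> at_point a p = 0" for p
  proof
    assume "\<pi> p \<in> P"
    then obtain r where r: "at_point a r = 0" "f dvd p - r" by (auto simp: P_def ker)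
    from at_point_dvd[OF r(2) f_at] r(1) show "at_point a p = 0" by simp
  qed (auto simp: P_def)
  have prime: "primeideal P ?B"
  proof (rule primeidealI2)
    show "additive_subgroup P ?B"
    proof (rule additive_subgroupI, rule \<pi>.S.add.subgroupI)
      fix x assume "x \<in> P"
      then obtain p where p: "at_point a p = 0" "x = \<pi> p" by (auto simp: P_def)
      have "\<ominus>\<^bsub>?B\<^esub> x = \<pi> (- p)" unfolding p
        by (rule \<pi>.S.minus_equality) (simp_all add: \<pi>_simps surj)
      then show "\<ominus>\<^bsub>?B\<^esub> x \<in> P" using p by (simp add: P)
    qed (auto simp: P_def surj \<pi>_simps intro!: imageI exI[of _ 0])
    show "carrier ?B \<noteq> P" using P[of 1] surj by auto
  qed (auto simp: P_def[symmetric] surj \<pi>_simps P intro: \<pi>.S.is_cring, auto simp: P_def \<pi>_simps)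
  let ?S = "carrier ?B - P"
  interpret L: mult_subset ?B ?S by (rule mult_subset_prime_compl[OF prime])
  let ?L = "localization ?B ?S"
  define \<phi> where "\<phi> p = mk_frac ?B ?S (\<pi> p) (\<pi> 1)" for p
  have S: "\<pi> p \<in> ?S \<longleftrightarrow> at_point a p \<noteq> 0" for p using P surj by auto
  have S1: "\<pi> 1 \<in> ?S" unfolding S by simp
  have car: "\<pi> p \<in> carrier ?B" for p using surj by auto
  have "ring_hom_ring ?R ?L \<phi>"
    by (rule ring_hom_ringI[OF ring_from_type_algebra cring.axioms(1)[OF L.cring_localization]])
      (auto simp: \<phi>_def L.localization_mult[OF car S1 car S1] L.localization_add[OF car S1 car S1]
        \<pi>_simps L.localization_one simp del: \<pi>.hom_one \<pi>.hom_zero intro!: L.frac_closed car S1)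
  then have "ring_hom_cring ?R ?L \<phi>"
    by (rule RingHom.ring_hom_cringI) (rule cring_from_type_algebra L.cring_localization)+
  moreover have "carrier ?L = range \<phi>"
  proof
    show "carrier ?L \<subseteq> range \<phi>"
    proof
      fix x assume "x \<in> carrier ?L"
      then obtain p s where x: "\<pi> s \<in> ?S" "x = mk_frac ?B ?S (\<pi> p) (\<pi> s)"
        by (elim L.frac_cases) (auto simp: surj)
      from x(1) have "at_point a s \<noteq> 0" unfolding S .
      with f0 c obtain v where v: "f dvd s * v - 1" by (rule unit_mod_if_nonzero_at_point)
      have "x = \<phi> (p * v)" unfolding x(2) \<phi>_def
      proof (rule L.frac_eqI[OF car x(1) car S1])
        have "f dvd 1 * p - s * (p * v)" using dvd_mult[OF v, of "- p"] by (simp add: algebra_simps)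
        then show "\<pi> 1 \<otimes>\<^bsub>?B\<^esub> \<pi> p = \<pi> s \<otimes>\<^bsub>?B\<^esub> \<pi> (p * v)" by (simp only: \<pi>_simps ker)
      qed
      then show "x \<in> range \<phi>" by simp
    qed
    show "range \<phi> \<subseteq> carrier ?L" by (auto simp: \<phi>_def intro!: L.frac_closed car S1)
  qed
  moreover have "\<phi> p = \<phi> r \<longleftrightarrow> f dvd p - r" for p r
  proof
    assume "f dvd p - r"
    then have "\<pi> p = \<pi> r" by (simp add: ker)
    then show "\<phi> p = \<phi> r" by (simp add: \<phi>_def)
  next
    assume "\<phi> p = \<phi> r"
    then obtain u where "\<pi> u \<in> ?S" "\<pi> u \<otimes>\<^bsub>?B\<^esub> (\<pi> 1 \<otimes>\<^bsub>?B\<^esub> \<pi> p) = \<pi> u \<otimes>\<^bsub>?B\<^esub> (\<pi> 1 \<otimes>\<^bsub>?B\<^esub> \<pi> r)"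
      unfolding \<phi>_def L.frac_eq_iff[OF car S1 car S1] using surj by auto
    then have u: "at_point a u \<noteq> 0" "f dvd u * p - u * r"
      unfolding S \<pi>_simps ker by simp_all
    obtain v where v: "f dvd u * v - 1" by (rule unit_mod_if_nonzero_at_point[OF f0 c u(1)])
    have "f dvd v * (u * p - u * r) - (u * v - 1) * (p - r)" using u(2) v by simp
    then show "f dvd p - r" by (simp add: algebra_simps)
  qed
  ultimately show thesis using prime that[of P \<phi>] by (simp add: local_ring_at_def)
qed

text \<open>
  The preimages of a chain of prime ideals form a chain of prime ideals of \<open>A\<close> that contain \<open>f\<close>.
\<close>

lemma krull_dim_le_one:
  fixes f :: "'k::field poly fps"
  assumes f0: "fps_nth f 0 = smult c ([:- a, 1:] ^ n)" and c: "c \<noteq> 0"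
    and hom: "ring_hom_cring series_ring L \<phi>" and surj: "carrier L = range \<phi>"
    and ker: "\<phi> f = \<phi> 0"
  shows "krull_dim L \<le> 1"
  unfolding krull_dim_def
proof (rule Sup_least, clarify)
  interpret \<phi>: ring_hom_cring "ring_of_type_algebra :: 'k poly fps ring" L \<phi> by (rule hom)
  fix n P
  assume P: "\<forall>i\<le>n. primeideal (P i) L" "\<forall>i<n. P i \<subset> P (Suc i)"
  have "n < 2"
  proof (rule ccontr)
    assume "\<not> n < 2"
    with P have Ps: "primeideal (P 0) L" "primeideal (P 1) L" "primeideal (P 2) L"
      and chain: "P 0 \<subset> P 1" "P 1 \<subset> P 2"
      by (auto simp: numeral_2_eq_2)
    define Q where "Q i = {p. \<phi> p \<in> P i}" for i
    have prime: "primeideal (Q i) ring_of_type_algebra" if "primeideal (P i) L" for i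
      using \<phi>.ring.primeideal_vimage[OF \<phi>.R.is_cring that] by (simp add: Q_def)
    have image: "P i = \<phi> ` Q i" if "primeideal (P i) L" for i
    proof -
      interpret primeideal "P i" L by fact
      show ?thesis using a_subset surj by (auto simp: Q_def)
    qed
    have strict: "Q i \<subset> Q j" if "P i \<subset> P j" "primeideal (P i) L" "primeideal (P j) L" for i j
      using that image[of i] image[of j] by (auto simp: Q_def)
    have "f \<in> Q 0"
    proof -
      interpret primeideal "P 0" L by (rule Ps)
      show ?thesis using ker \<phi>.hom_zero additive_subgroup.zero_closed[OF is_additive_subgroup]
        by (simp add: Q_def)
    qed
    from prime_chain_length[OF f0 c prime[OF Ps(1)] prime[OF Ps(2)] prime[OF Ps(3)]
        strict[OF chain(1) Ps(1,2)] strict[OF chain(2) Ps(2,3)] this]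
    show False .
  qed
  then show "enat n \<le> 1" by (simp add: one_enat_def)
qed

text \<open>
  Regularity bounds the number of generators of the maximal ideal by the dimension, which is at
  most one. A generator lifts to \<open>t\<close> in \<open>A\<close>. Since \<open>y\<close> lies in \<open>(f,t)\<close> and is not a zero divisor
  modulo \<open>f\<close>, neither is \<open>t\<close>.
\<close>

lemma nonsingular_local_parameter:
  fixes f :: "'k::field poly fps"
  assumes f0: "fps_nth f 0 = smult c ([:- a, 1:] ^ n)" and c: "c \<noteq> 0" and n: "n > 0"
    and nonsing: "nonsingular_curve f"
  obtains t where "local_parameter f t a"
proof -
  let ?R = "ring_of_type_algebra :: 'k poly fps ring"
  obtain P \<phi> where P: "primeideal P (coordinate_ring f)"
    and hom: "ring_hom_cring ?R (local_ring_at (coordinate_ring f) P) \<phi>"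
    and surj: "carrier (local_ring_at (coordinate_ring f) P) = range \<phi>"
    and ker: "\<And>p r. \<phi> p = \<phi> r \<longleftrightarrow> f dvd p - r"
    using local_ring_presentation[OF f0 c n] by blast
  let ?L = "local_ring_at (coordinate_ring f) P"
  interpret \<phi>: ring_hom_cring ?R ?L \<phi> by (rule hom)
  have f_at: "at_point a f = 0" using n by (simp add: at_point_def f0)
  have "regular_local_ring ?L"
    using nonsing P by (simp add: nonsingular_curve_def regular_Spec_def)
  then obtain M A where M: "{J. maximalideal J ?L} = {M}" and A: "A \<subseteq> carrier ?L" "finite A"
    and gen: "Idl\<^bsub>?L\<^esub> A = M" and dim: "enat (card A) = krull_dim ?L"
    unfolding regular_local_ring_def by blast
  have "maximalideal M ?L" using equalityD2[OF M] by simp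
  then interpret M: maximalideal M ?L .
  have "enat (card A) \<le> 1"
    unfolding dim by (rule krull_dim_le_one[OF f0 c hom surj]) (simp add: ker)
  then have "card A \<le> 1" by (simp add: one_enat_def)
  \<comment> \<open>the empty set generates the zero ideal, for which \<open>0\<close> serves as the single generator\<close>
  then obtain x where x: "x \<in> M" and Ax: "A \<subseteq> {x}"
  proof (cases "A = {}")
    case True
    then show ?thesis
      using that additive_subgroup.zero_closed[OF M.is_additive_subgroup] by blast
  next
    case False
    with \<open>card A \<le> 1\<close> A(2) have "card A = 1" by (simp add: le_Suc_eq)
    then obtain x where "A = {x}" by (rule card_1_singletonE)
    moreover from this have "x \<in> M" using \<phi>.S.genideal_self[OF A(1)] gen by blast
    ultimately show ?thesis using that by blast
  qed
  obtain t where t: "x = \<phi> t" using x M.Icarr surj by blast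
  have xL: "x \<in> carrier ?L" using x by (rule M.Icarr)
  have "M \<subseteq> PIdl\<^bsub>?L\<^esub> x"
    unfolding gen[symmetric] using Ax \<phi>.S.cgenideal_self[OF xL]
    by (intro \<phi>.S.genideal_minimal \<phi>.S.cgenideal_ideal xL) blast
  then have principal: "\<exists>b. p = \<phi> b \<otimes>\<^bsub>?L\<^esub> \<phi> t" if "p \<in> M" for p
    using that surj by (auto simp: cgenideal_def t)
  have outside: "\<phi> p \<notin> M" if p: "at_point a p \<noteq> 0" for p
  proof
    assume "\<phi> p \<in> M"
    obtain v where "f dvd p * v - 1" by (rule unit_mod_if_nonzero_at_point[OF f0 c p])
    then have "\<phi> (p * v) = \<phi> 1" by (simp add: ker)
    then have "\<phi> p \<otimes>\<^bsub>?L\<^esub> \<phi> v = \<one>\<^bsub>?L\<^esub>"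
      using \<phi>.hom_mult[of p v] \<phi>.hom_one by simp
    moreover have "\<phi> p \<otimes>\<^bsub>?L\<^esub> \<phi> v \<in> M"
      using \<open>\<phi> p \<in> M\<close> surj by (intro M.I_r_closed) auto
    ultimately show False using M.one_imp_carrier M.I_notcarr by simp
  qed
  have inside: "\<phi> p \<in> M" if "at_point a p = 0" for p
  proof -
    define J where "J = \<phi> ` {p. at_point a p = 0}"
    have "ideal J ?L"
    proof (rule idealI)
      show "subgroup J (add_monoid ?L)"
      proof (rule \<phi>.S.add.subgroupI)
        show "J \<noteq> {}" by (auto simp: J_def intro: exI[of _ 0])
        fix x assume "x \<in> J"
        then obtain p where p: "at_point a p = 0" "x = \<phi> p" by (auto simp: J_def)
        have "\<ominus>\<^bsub>?L\<^esub> x = \<phi> (- p)" unfolding p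
          using \<phi>.hom_add[of "- p" p] \<phi>.hom_zero surj by (intro \<phi>.S.minus_equality) auto
        then show "\<ominus>\<^bsub>?L\<^esub> x \<in> J" using p by (auto simp: J_def)
        fix y assume "y \<in> J"
        then obtain r where r: "at_point a r = 0" "y = \<phi> r" by (auto simp: J_def)
        show "x \<oplus>\<^bsub>?L\<^esub> y \<in> J" unfolding p r
          using \<phi>.hom_add[of p r] p r by (auto simp: J_def intro!: image_eqI[of _ _ "p + r"])
      qed (use surj in \<open>auto simp: J_def\<close>)
      fix x y assume "x \<in> J" "y \<in> carrier ?L"
      then obtain p r where p: "at_point a p = 0" "x = \<phi> p" "y = \<phi> r" by (auto simp: J_def surj)
      show "x \<otimes>\<^bsub>?L\<^esub> y \<in> J" unfolding p
        using \<phi>.hom_mult[of p r] p by (auto simp: J_def intro!: image_eqI[of _ _ "p * r"])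
      show "y \<otimes>\<^bsub>?L\<^esub> x \<in> J" unfolding p
        using \<phi>.hom_mult[of r p] p by (auto simp: J_def intro!: image_eqI[of _ _ "r * p"])
    qed (rule \<phi>.S.ring_axioms)
    moreover have "M \<subseteq> J"
    proof
      fix x assume "x \<in> M"
      moreover from this obtain p where "x = \<phi> p" using M.Icarr surj by blast
      ultimately show "x \<in> J" using outside[of p] by (auto simp: J_def)
    qed
    moreover have "J \<subseteq> carrier ?L" using surj by (auto simp: J_def)
    ultimately have "J = M \<or> J = carrier ?L" by (rule M.I_maximal)
    moreover have "\<phi> 1 \<notin> J"
    proof
      assume "\<phi> 1 \<in> J"
      then obtain p where "at_point a p = 0" "f dvd 1 - p" by (auto simp: J_def ker)
      then show False using at_point_dvd[OF _ f_at, of "1 - p"] by simp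
    qed
    ultimately show ?thesis using that surj by (auto simp: J_def)
  qed
  have t_at: "at_point a t = 0" using outside x t by blast
  have generates: "\<exists>b. f dvd p - t * b" if "at_point a p = 0" for p
  proof -
    from principal[OF inside[OF that]] obtain b where "\<phi> p = \<phi> b \<otimes>\<^bsub>?L\<^esub> \<phi> t" ..
    also have "\<dots> = \<phi> (b * t)" using \<phi>.hom_mult[of b t] by simp
    finally show ?thesis by (auto simp: ker mult.commute)
  qed
  obtain b where b: "f dvd fps_X - t * b" using generates[of fps_X] by auto
  have regular: "f dvd z" if z: "f dvd t * z" for z
  proof -
    have "f dvd (fps_X - t * b) * z + t * z * b" using b z by simp
    also have "\<dots> = fps_X ^ 1 * z" by (simp add: algebra_simps)
    finally show ?thesis
      by (rule dvd_fps_X_power_mult_cancel[rotated]) (simp add: fps_X_dvd_iff f0 c)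
  qed
  have "local_parameter f t a"
    by (rule local_parameter.intro) (fact f_at t_at generates regular)+
  then show thesis by (rule that)
qed

section \<open>Reciprocity\<close>

lemma fps_X_irreducible: "Factorial_Ring.irreducible (fps_X :: 'a::idom fps)"
proof (rule irreducibleI)
  fix a b :: "'a fps"
  assume ab: "fps_X = a * b"
  then have "fps_nth a 0 * fps_nth b 0 = 0" by (metis fps_X_nth fps_mult_nth_0 zero_neq_one)
  then have "fps_X dvd a \<or> fps_X dvd b" by (simp add: fps_X_dvd_iff)
  then show "a dvd 1 \<or> b dvd 1"
  proof
    assume "fps_X dvd a"
    then obtain c where "a = fps_X * c" ..
    with ab have "fps_X * 1 = fps_X * (c * b)" by (simp add: mult.assoc)
    then have "1 = c * b" by (subst (asm) mult_cancel_left) simp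
    then show ?thesis by (metis dvd_triv_right)
  next
    assume "fps_X dvd b"
    then obtain c where "b = fps_X * c" ..
    with ab have "fps_X * 1 = fps_X * (c * a)" by (simp add: mult_ac)
    then have "1 = c * a" by (subst (asm) mult_cancel_left) simp
    then show ?thesis by (metis dvd_triv_right)
  qed
qed (simp_all add: fps_dvd_one_iff)

lemma irreducible_dvd_irreducible:
  fixes f g :: "'a::idom"
  assumes "Factorial_Ring.irreducible f" "Factorial_Ring.irreducible g" "g dvd f"
  shows "f dvd g"
proof -
  from assms(3) obtain c where c: "f = g * c" ..
  with assms(1,2) have "c dvd 1" by (auto dest: irreducibleD irreducible_not_unit)
  then obtain d where "1 = c * d" ..
  then have "g = f * d" by (simp add: c mult.assoc)
  then show ?thesis ..
qed

lemma power_modulo_if_dvd: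
  assumes "q > 0" "f dvd g"
  shows "power_modulo q g f"
proof -
  have "f dvd g - 0 ^ q" using assms by (simp add: zero_power)
  then show ?thesis unfolding power_modulo_def ..
qed

text \<open>
  \<open>h\<close> is not a zero divisor modulo \<open>g\<close>. If \<open>y\<close> does not divide \<open>g\<close>, then \<open>y\<close> is not a zero divisor modulo
  \<open>g\<close>, and some power of \<open>y\<close> lies in \<open>(f,g) = (g,h\<^sup>q)\<close>; so \<open>h z \<equiv> 0\<close> gives \<open>y\<^sup>j z \<equiv> 0\<close> and
  \<open>z \<equiv> 0\<close>. If \<open>y\<close> divides \<open>g\<close>, the two are associates, so \<open>g\<close> is prime, and it does not divide
  \<open>h\<close> because it does not divide \<open>f\<close>.
\<close>

lemma cancel_root_mod:
  fixes f g h :: "'k::field poly fps"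
  assumes g: "Factorial_Ring.irreducible g" and ngf: "\<not> g dvd f"
    and fh: "g dvd f - h ^ q" "q > 0" and X: "fps_X ^ j = f * x + g * y"
    and z: "g dvd h * z"
  shows "g dvd z"
proof (cases "fps_X dvd g")
  case True
  with g have "g dvd fps_X" by (rule irreducible_dvd_irreducible[OF _ fps_X_irreducible])
  then have iff: "g dvd p \<longleftrightarrow> fps_X dvd p" for p using True by (blast intro: dvd_trans)
  from z have "g dvd h \<or> g dvd z" unfolding iff by (simp add: fps_X_dvd_iff)
  moreover have "\<not> g dvd h"
  proof
    assume "g dvd h"
    then have "g dvd h ^ q" using fh(2) by (metis dvd_power dvd_trans)
    with fh(1) have "g dvd f - h ^ q + h ^ q" by (rule dvd_add)
    with ngf show False by simp
  qed
  ultimately show ?thesis by blast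
next
  case False
  obtain p where q: "q = Suc p" using fh(2) by (cases q) auto
  have "g dvd (f - h ^ q) * x * z + h * z * (h ^ p * x) + g * y * z" using fh(1) z by simp
  also have "\<dots> = fps_X ^ j * z" unfolding X by (simp add: q algebra_simps)
  finally show ?thesis by (rule dvd_fps_X_power_mult_cancel[OF False])
qed

text \<open>
  \<open>y\<close> vanishes at the point, so it is a multiple of \<open>t\<close> modulo \<open>f\<close>, and \<open>y\<^sup>m\<close> lies in
  \<open>(f,t\<^sup>m) = (f,g)\<close>. Then \<open>h\<close> is not a zero divisor modulo \<open>g\<close>, \<open>m = q r\<close> for some \<open>r\<close>, and
  \<open>g \<equiv> (t\<^sup>r z)\<^sup>q\<close>.
\<close>

lemma (in local_parameter) power_modulo_reciprocity:
  assumes g: "Factorial_Ring.irreducible g" and ngf: "\<not> g dvd f"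
    and gt: "f dvd g - t ^ m * w" and w: "at_point a w \<noteq> 0" and v: "f dvd w * v - 1"
    and z: "f dvd w - z ^ q" and q: "q > 1" and fg: "power_modulo q f g"
  shows "power_modulo q g f"
proof -
  from fg obtain h where h: "g dvd f - h ^ q" by (auto simp: power_modulo_def)
  obtain b where "f dvd fps_X - t * b" using generates[of fps_X] by auto
  also have "fps_X - t * b dvd fps_X ^ m - (t * b) ^ m"
    unfolding power_diff_sumr2 by (rule dvd_triv_left)
  finally have "f dvd fps_X ^ m - t ^ m * b ^ m" by (simp only: power_mult_distrib)
  then have "f dvd (fps_X ^ m - t ^ m * b ^ m) - v * b ^ m * (g - t ^ m * w) - t ^ m * b ^ m * (w * v - 1)"
    using gt v by simp
  also have "\<dots> = fps_X ^ m - g * (v * b ^ m)" by (simp add: algebra_simps)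
  finally obtain x where "fps_X ^ m - g * (v * b ^ m) = f * x" ..
  then have X: "fps_X ^ m = f * x + g * (v * b ^ m)" by (simp add: algebra_simps)
  have "g dvd z" if "g dvd h * z" for z
    using cancel_root_mod[OF g ngf h _ X that] q by simp
  from exponent_dvd_order[OF gt w v h q this] obtain r where m: "m = q * r" by blast
  have "f dvd (g - t ^ m * w) + t ^ m * (w - z ^ q)" using gt z by simp
  also have "\<dots> = g - (t ^ r * z) ^ q"
    by (simp add: m power_mult_distrib power_mult[symmetric] mult.commute[of r] algebra_simps)
  finally show ?thesis unfolding power_modulo_def by blast
qed

text \<open>
  The order of \<open>g\<close> is finite by the \<open>y\<close>-adic closedness of \<open>(f)\<close>: since \<open>t\<^sup>n\<close> lies in \<open>(f,y)\<close>, a series in all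
  \<open>(f,t\<^sup>i)\<close> lies in all \<open>(f,y\<^sup>i)\<close>.
\<close>

lemma (in local_parameter) order_obtain:
  assumes f0: "fps_nth f 0 = smult c ([:- a, 1:] ^ n)" and c: "c \<noteq> 0" and nfg: "\<not> f dvd g"
  obtains m w where "at_point a w \<noteq> 0" "f dvd g - t ^ m * w"
proof -
  obtain u r where ur: "t ^ n = f * u + fps_X * r" by (rule at_point_power_mod[OF f0 c vanishes])
  have "\<exists>i. \<forall>b. \<not> f dvd g - t ^ i * b"
  proof (rule ccontr)
    assume "\<nexists>i. \<forall>b. \<not> f dvd g - t ^ i * b"
    then have all: "\<exists>b. f dvd g - t ^ i * b" for i by blast
    have "f dvd g"
    proof (rule principal_ideal_closed)
      show "\<not> fps_X dvd f" using c by (simp add: fps_X_dvd_iff f0)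
      fix i
      obtain b where b: "f dvd g - t ^ (n * i) * b" using all by blast
      have "f dvd t ^ n - fps_X * r" by (simp add: ur)
      also have "t ^ n - fps_X * r dvd (t ^ n) ^ i - (fps_X * r) ^ i"
        unfolding power_diff_sumr2 by (rule dvd_triv_left)
      finally have "f dvd (g - t ^ (n * i) * b) + ((t ^ n) ^ i - (fps_X * r) ^ i) * b"
        using b by simp
      also have "\<dots> = g - fps_X ^ i * (r ^ i * b)"
        by (simp only: power_mult[of t] power_mult_distrib) (simp add: algebra_simps)
      finally obtain s where "g = fps_X ^ i * (r ^ i * b) + f * s" by (rule dvd_diff_obtain)
      then have "fps_X ^ i dvd g - f * s" by simp
      then show "\<exists>s. fps_X ^ i dvd g - f * s" ..
    qed
    with nfg show False ..
  qed
  then obtain i where i: "\<And>b. \<not> f dvd g - t ^ i * b" by blast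
  show thesis
    by (rule order_cases[of g i]) (use i that in blast)+
qed

lemma local_parameter_fps_X:
  fixes f :: "'k::field poly fps"
  assumes "f dvd fps_X" "fps_X dvd f"
  shows "local_parameter f (fps_const [:- a, 1:]) a"
proof
  have iff: "f dvd p \<longleftrightarrow> fps_X dvd p" for p using assms by (blast intro: dvd_trans)
  show "at_point a f = 0" using assms(2) by (rule at_point_dvd) simp
  show "at_point a (fps_const [:- a, 1:]) = 0" by simp
  show "\<exists>b. f dvd p - fps_const [:- a, 1:] * b" if "at_point a p = 0" for p
  proof -
    have "[:- a, 1:] dvd fps_nth p 0" using that by (simp add: at_point_def poly_eq_0_iff_dvd)
    then obtain b c where "p = fps_const [:- a, 1:] * b + fps_X * c"
      by (metis dvd_fps_X_mod_obtain fps_nth_fps_const)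
    then have "fps_X dvd p - fps_const [:- a, 1:] * b" by simp
    then show ?thesis unfolding iff ..
  qed
  show "f dvd z" if "f dvd fps_const [:- a, 1:] * z" for z
    using that unfolding iff by (simp only: fps_X_dvd_iff fps_mult_nth_0 mult_eq_0_iff) simp
qed

theorem corollary3p8:
  fixes f g :: "'k :: alg_closed_field poly fps"
    and q :: nat
  assumes "Factorial_Ring.prime q" and "q \<noteq> CHAR('k)"
    and "f \<noteq> 0" and "Factorial_Ring.irreducible f"
    and "g \<noteq> 0" and "Factorial_Ring.irreducible g"
    and "nonsingular_curve f"
    and "power_modulo q f g"
  shows "power_modulo q g f"
proof (cases "f dvd g")
  case True
  then show ?thesis using assms(1) by (intro power_modulo_if_dvd) (simp_all add: prime_gt_0_nat)
next
  case nfg: False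
  then have ngf: "\<not> g dvd f" using irreducible_dvd_irreducible assms(4,6) by blast
  have q: "q > 1" using assms(1) by (rule prime_gt_1_nat)
  have "CHAR('k) \<noteq> 1" using of_nat_CHAR[where 'a = 'k] by (metis of_nat_1 zero_neq_one)
  then have q0: "of_nat q \<noteq> (0 :: 'k)"
    using assms(1,2) by (auto simp: of_nat_eq_0_iff_char_dvd prime_nat_iff)
  show ?thesis
  proof (cases "fps_X dvd f")
    case True
    then have fX: "f dvd fps_X"
      by (rule irreducible_dvd_irreducible[OF assms(4) fps_X_irreducible])
    with nfg have "\<not> fps_X dvd g" by (blast intro: dvd_trans)
    then obtain c a m where c: "c \<noteq> 0" and g0: "fps_nth g 0 = smult c ([:- a, 1:] ^ m)"
      using irreducible_constant_coefficient[OF assms(6)] by metis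
    interpret local_parameter f "fps_const [:- a, 1:]" a
      using fX True by (rule local_parameter_fps_X)
    obtain \<zeta> where "\<zeta> ^ q = c" using nth_root_exists q by (metis less_trans zero_less_one)
    then have z: "f dvd fps_const [:c:] - fps_const [:\<zeta>:] ^ q" by (simp add: poly_const_pow)
    have gt: "f dvd g - fps_const [:- a, 1:] ^ m * fps_const [:c:]"
      by (rule dvd_trans[OF fX]) (simp add: fps_X_dvd_iff g0)
    have v: "f dvd fps_const [:c:] * fps_const [:inverse c:] - 1"
      using c by (simp add: one_pCons[symmetric])
    show ?thesis
      by (rule power_modulo_reciprocity[OF assms(6) ngf gt _ v z q assms(8)]) (simp add: c)
  next
    case False
    then obtain c a n where c: "c \<noteq> 0" and n: "n > 0"
      and f0: "fps_nth f 0 = smult c ([:- a, 1:] ^ n)"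
      using irreducible_constant_coefficient[OF assms(4)] by metis
    obtain t where "local_parameter f t a"
      using f0 c n assms(7) by (rule nonsingular_local_parameter)
    then interpret local_parameter f t a .
    obtain m w where w: "at_point a w \<noteq> 0" and g: "f dvd g - t ^ m * w"
      using f0 c nfg by (rule order_obtain)
    obtain v where v: "f dvd w * v - 1" using f0 c w by (rule unit_mod_if_nonzero_at_point)
    obtain z where "f dvd w - z ^ q"
      using f0 c _ q0 w by (rule root_mod_if_nonzero_at_point) (use q in simp)
    with assms(6) ngf g w v show ?thesis
      using q assms(8) by (rule power_modulo_reciprocity)
  qed
qed

end
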